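(* Let $\Lambda$ be a finite-dimensional self-injective algebra over a field $k$ of radical length at least $3$. Then for every $N$ there exists an indecomposable perfect complex $X$ of $\Lambda$-modules with $\dim_k H_0(X)>N$.
   Context: The radical length of $\Lambda$ is the least $r$ with $(\operatorname{Rad}\Lambda)^r=0$. A perfect complex is a bounded chain complex of finitely generated projective $\Lambda$-modules, indexed homologically; indecomposability is taken in the homotopy category $D^b(\Lambda\text{-proj})$ of perfect complexes. *)

theory Defs
  imports Complex_Main "HOL-Library.Function_Algebras"
begin

definition fd_algebra :: "('k::field \<Rightarrow> 'a::ring_1 \<Rightarrow> 'a) \<Rightarrow> bool" where
  "fd_algebra sc \<longleftrightarrow> vector_space sc
     \<and> (\<exists>S. finite S \<and> module.span sc S = UNIV)
     \<and> (\<forall>c x y. sc c (x * y) = sc c x * y \<and> sc c (x * y) = x * sc c y)"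

definition left_ideal :: "'a::ring_1 set \<Rightarrow> bool" where
  "left_ideal L \<longleftrightarrow> 0 \<in> L \<and> (\<forall>x\<in>L. \<forall>y\<in>L. x + y \<in> L) \<and> (\<forall>a. \<forall>x\<in>L. a * x \<in> L)"

definition maximal_left_ideal :: "'a::ring_1 set \<Rightarrow> bool" where
  "maximal_left_ideal L \<longleftrightarrow> left_ideal L \<and> L \<noteq> UNIV
     \<and> (\<forall>L'. left_ideal L' \<and> L \<subseteq> L' \<longrightarrow> L' = L \<or> L' = UNIV)"

definition jrad :: "'a::ring_1 itself \<Rightarrow> 'a set" where
  "jrad _ = \<Inter> {L. maximal_left_ideal L}"

definition ideal_pow :: "'a::ring_1 set \<Rightarrow> nat \<Rightarrow> 'a set" where
  "ideal_pow I r = \<Inter> {A. 0 \<in> A \<and> (\<forall>x\<in>A. \<forall>y\<in>A. x + y \<in> A) \<and> (\<forall>x\<in>A. - x \<in> A)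
       \<and> {prod_list xs | xs. length xs = r \<and> set xs \<subseteq> I} \<subseteq> A}"

definition radical_length :: "'a::ring_1 itself \<Rightarrow> nat" where
  "radical_length T = (LEAST r. ideal_pow (jrad T) r = {0})"

text \<open>Modules are realised as Lambda-submodules of the left module nat \<Rightarrow> 'a
  (componentwise operations).  Every finitely generated projective module is
  isomorphic to such a submodule.\<close>

type_synonym 'a vec = "nat \<Rightarrow> 'a"

definition act :: "'a::ring_1 \<Rightarrow> 'a vec \<Rightarrow> 'a vec" where
  "act a v = (\<lambda>i. a * v i)"

definition submod :: "'a::ring_1 vec set \<Rightarrow> bool" where
  "submod M \<longleftrightarrow> 0 \<in> M \<and> (\<forall>x\<in>M. \<forall>y\<in>M. x + y \<in> M) \<and> (\<forall>a. \<forall>x\<in>M. act a x \<in> M)"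

definition lin :: "'a::ring_1 vec set \<Rightarrow> 'a vec set \<Rightarrow> ('a vec \<Rightarrow> 'a vec) \<Rightarrow> bool" where
  "lin M N f \<longleftrightarrow> (\<forall>x\<in>M. f x \<in> N) \<and> (\<forall>x\<in>M. \<forall>y\<in>M. f (x + y) = f x + f y)
     \<and> (\<forall>a. \<forall>x\<in>M. f (act a x) = act a (f x))"

definition free :: "nat \<Rightarrow> 'a::ring_1 vec set" where
  "free n = {v. \<forall>i\<ge>n. v i = 0}"

definition fg_proj :: "'a::ring_1 vec set \<Rightarrow> bool" where
  "fg_proj P \<longleftrightarrow> submod P \<and> (\<exists>n f g. lin P (free n) f \<and> lin (free n) P g \<and> (\<forall>x\<in>P. g (f x) = x))"

definition lin_to_ring :: "'a::ring_1 vec set \<Rightarrow> ('a vec \<Rightarrow> 'a) \<Rightarrow> bool" where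
  "lin_to_ring M f \<longleftrightarrow> (\<forall>x\<in>M. \<forall>y\<in>M. f (x + y) = f x + f y) \<and> (\<forall>a. \<forall>x\<in>M. f (act a x) = a * f x)"

definition self_injective :: "'a::ring_1 itself \<Rightarrow> bool" where
  "self_injective _ \<longleftrightarrow> (\<forall>(M::'a vec set) N f. submod M \<and> submod N \<and> N \<subseteq> M \<and> lin_to_ring N f
      \<longrightarrow> (\<exists>g. lin_to_ring M g \<and> (\<forall>x\<in>N. g x = f x)))"

section \<open>Complexes, homological indexing: d n : X n \<rightarrow> X (n - 1)\<close>

type_synonym 'a cpx = "(int \<Rightarrow> 'a vec set) \<times> (int \<Rightarrow> 'a vec \<Rightarrow> 'a vec)"

definition perfect :: "'a::ring_1 cpx \<Rightarrow> bool" where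
  "perfect C \<longleftrightarrow> (\<forall>n. fg_proj (fst C n)) \<and> (\<forall>n. lin (fst C n) (fst C (n - 1)) (snd C n))
     \<and> (\<forall>n. \<forall>x\<in>fst C n. snd C (n - 1) (snd C n x) = 0)
     \<and> (\<exists>B. \<forall>n. \<bar>n\<bar> > B \<longrightarrow> fst C n = {0})"

definition chain_map :: "'a::ring_1 cpx \<Rightarrow> 'a cpx \<Rightarrow> (int \<Rightarrow> 'a vec \<Rightarrow> 'a vec) \<Rightarrow> bool" where
  "chain_map C D f \<longleftrightarrow> (\<forall>n. lin (fst C n) (fst D n) (f n))
     \<and> (\<forall>n. \<forall>x\<in>fst C n. snd D n (f n x) = f (n - 1) (snd C n x))"

definition homotopic :: "'a::ring_1 cpx \<Rightarrow> 'a cpx \<Rightarrow> (int \<Rightarrow> 'a vec \<Rightarrow> 'a vec) \<Rightarrow> (int \<Rightarrow> 'a vec \<Rightarrow> 'a vec) \<Rightarrow> bool" where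
  "homotopic C D f g \<longleftrightarrow> (\<exists>h. (\<forall>n. lin (fst C n) (fst D (n + 1)) (h n))
     \<and> (\<forall>n. \<forall>x\<in>fst C n. f n x - g n x = snd D (n + 1) (h n x) + h (n - 1) (snd C n x)))"

definition cid :: "int \<Rightarrow> 'a vec \<Rightarrow> 'a vec" where "cid = (\<lambda>n x. x)"
definition czero :: "int \<Rightarrow> 'a::zero vec \<Rightarrow> 'a vec" where "czero = (\<lambda>n x. 0)"
definition ccomp :: "(int \<Rightarrow> 'a vec \<Rightarrow> 'a vec) \<Rightarrow> (int \<Rightarrow> 'a vec \<Rightarrow> 'a vec) \<Rightarrow> int \<Rightarrow> 'a vec \<Rightarrow> 'a vec"
  where "ccomp g f = (\<lambda>n x. g n (f n x))"

text \<open>Zero objects of the homotopy category = contractible complexes.\<close>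
definition contractible :: "'a::ring_1 cpx \<Rightarrow> bool" where
  "contractible C \<longleftrightarrow> homotopic C C cid czero"

definition is_biproduct :: "'a::ring_1 cpx \<Rightarrow> 'a cpx \<Rightarrow> 'a cpx \<Rightarrow> bool" where
  "is_biproduct X Y Z \<longleftrightarrow> (\<exists>i1 i2 p1 p2.
     chain_map Y X i1 \<and> chain_map Z X i2 \<and> chain_map X Y p1 \<and> chain_map X Z p2
     \<and> homotopic Y Y (ccomp p1 i1) cid \<and> homotopic Z Z (ccomp p2 i2) cid
     \<and> homotopic Y Z (ccomp p2 i1) czero \<and> homotopic Z Y (ccomp p1 i2) czero
     \<and> homotopic X X (\<lambda>n x. i1 n (p1 n x) + i2 n (p2 n x)) cid)"

definition indecomposable :: "'a::ring_1 cpx \<Rightarrow> bool" where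
  "indecomposable X \<longleftrightarrow> perfect X \<and> \<not> contractible X
     \<and> (\<forall>Y Z. perfect Y \<and> perfect Z \<and> is_biproduct X Y Z \<longrightarrow> contractible Y \<or> contractible Z)"

definition vsc :: "('k \<Rightarrow> 'a \<Rightarrow> 'a) \<Rightarrow> 'k \<Rightarrow> 'a vec \<Rightarrow> 'a vec" where
  "vsc sc c v = (\<lambda>i. sc c (v i))"

definition H0_dim :: "('k::field \<Rightarrow> 'a::ring_1 \<Rightarrow> 'a) \<Rightarrow> 'a cpx \<Rightarrow> nat" where
  "H0_dim sc C = vector_space.dim (vsc sc) {x \<in> fst C 0. snd C 0 x = 0}
                 - vector_space.dim (vsc sc) (snd C 1 ` fst C 1)"

end

theory Submission
  imports Defs "HOL-Library.Nat_Bijection"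
begin

text \<open>Let \<open>J\<close> be the radical. Since the algebra is self-injective, a map between projectives has
  image in the radical if and only if it kills the socle; call such a map radical. Start from an
  indecomposable projective \<open>P\<close>, the cover of a simple submodule of \<open>J\<^sup>2\<close> (nonzero as the radical
  length is at least 3), and build complexes upwards: on top of a term \<open>B\<close> put the projective cover
  either of the socle of \<open>B\<close> or of \<open>JB\<close>. If no two consecutive steps are of the second kind this is
  a complex. Such complexes are encoded by words, and one can find \<open>n\<close> words with common first letter
  such that every chain map between the complexes of two different words is radical above \<open>P\<close>.
  Glue these \<open>n\<close> complexes along \<open>P\<close>. A chain endomorphism of the result that is radical on \<open>P\<close>
  is nilpotent: just above \<open>P\<close> its off-diagonal components are radical by the choice of the words, hence
  so are the diagonal ones, and nilpotence then propagates upwards because the kernels of the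
  differentials lie in the radical. As \<open>P\<close> is local, the glued complex is indecomposable, and its top
  homology contains the socle of its top term, which has \<open>n\<close> nonzero summands.\<close>

section \<open>Modules and left ideals\<close>

text \<open>The obstacle sits just above \<open>P\<close>. All words begin with the socle letter, so
  the \<open>n\<close> modules there are equal and carry the same map onto the socle of
  \<open>P\<close>; for \<open>n\<close> at least 2 the kernel of the sum of these maps is not
  radical, and an endomorphism vanishing on \<open>P\<close> could mix the towers. The words must
  exclude this for maps in both directions. A radical letter in the source against a socle letter in
  the target makes the map radical at once; the reverse pair gives nothing by itself. Downwards,
  radicality passes through equal letters, and through two levels with source socle, radical and
  target radical, socle. So four letters settle both directions. The fifth is a leading socle
  letter: a block ends with a radical letter, the deviating part of a word starts with one, and two
  consecutive radical steps do not compose to zero. Throughout, every term \<open>B\<close> must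
  have its socle inside \<open>J^2 B\<close>; \<open>proj3\<close> carries this up the towers, and
  radical length at least 3 provides the start.\<close>

context vector_space
begin

text \<open>\<open>dim\<close> is a natural number that is 0 in infinite dimension; confinement to
  the span of a finite set restores strict monotonicity.\<close>

lemma dim_psubset:
  assumes "finite S" "B \<subseteq> span S" "subspace A" "A \<subset> B"
  shows "dim A < dim B"
proof -
  obtain x where x: "x \<in> B" "x \<notin> A" using assms by blast
  obtain bA where bA: "bA \<subseteq> A" "independent bA" "A \<subseteq> span bA" "card bA = dim A"
    using basis_exists by blast
  obtain bB where bB: "bB \<subseteq> B" "independent bB" "B \<subseteq> span bB" "card bB = dim B"
    using basis_exists by blast
  have fB: "finite bB" using independent_span_bound[OF assms(1) bB(2)] bB(1) assms(2) by blast
  have "span bA \<subseteq> A" using span_minimal[OF bA(1) assms(3)] .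
  then have ind: "independent (insert x bA)" using bA(2) x independent_insert by auto
  have sub: "insert x bA \<subseteq> span bB" using x bA(1) assms(4) bB(3) by blast
  have "finite (insert x bA) \<and> card (insert x bA) \<le> card bB"
    using independent_span_bound[OF fB ind sub] .
  moreover have "x \<notin> bA" "finite bA" using calculation bA(1) x by auto
  ultimately show ?thesis using bA(4) bB(4) by auto
qed

lemma dim_ge_card:
  assumes "finite S" "B \<subseteq> span S" "independent A" "A \<subseteq> B"
  shows "card A \<le> dim B"
proof -
  obtain bB where bB: "bB \<subseteq> B" "independent bB" "B \<subseteq> span bB" "card bB = dim B"
    using basis_exists by blast
  have fB: "finite bB" using independent_span_bound[OF assms(1) bB(2)] bB(1) assms(2) by blast
  show ?thesis using independent_span_bound[OF fB assms(3)] assms(4) bB by auto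
qed

lemma ex_minimal_subspace:
  assumes "finite S" "Q A" "\<And>A. Q A \<Longrightarrow> subspace A \<and> A \<subseteq> span S"
  shows "\<exists>A. Q A \<and> (\<forall>B. Q B \<and> B \<subseteq> A \<longrightarrow> B = A)"
proof -
  obtain A where A: "Q A" "\<And>B. Q B \<Longrightarrow> dim A \<le> dim B"
    using ex_has_least_nat[of Q A dim] assms(2) by blast
  have "B = A" if "Q B" "B \<subseteq> A" for B
    using dim_psubset[OF assms(1), of A B] A(2)[OF that(1)] assms(3)[OF that(1)] assms(3)[OF A(1)] that(2)
    by (meson not_less psubsetI)
  then show ?thesis using A by blast
qed

lemma ex_maximal_subspace:
  assumes "finite S" "Q A" "\<And>A. Q A \<Longrightarrow> subspace A \<and> A \<subseteq> span S"
  shows "\<exists>A. Q A \<and> (\<forall>B. Q B \<and> A \<subseteq> B \<longrightarrow> B = A)"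
proof -
  have bd: "dim B \<le> card S" if "Q B" for B
    using dim_le_card[of B S] assms(1) assms(3)[OF that] by blast
  obtain A where A: "Q A" "\<And>B. Q B \<Longrightarrow> dim B \<le> dim A"
    using ex_has_greatest_nat[of Q A dim "Suc (card S)"] assms(2) bd less_Suc_eq_le by metis
  have "B = A" if "Q B" "A \<subseteq> B" for B
  proof (rule ccontr)
    assume "B \<noteq> A"
    then have "dim A < dim B"
      using dim_psubset[OF assms(1), of B A] assms(3)[OF that(1)] assms(3)[OF A(1)] that(2) by blast
    then show False using A(2)[OF that(1)] by simp
  qed
  then show ?thesis using A by blast
qed

end

text \<open>The induction methods eta-expand function-typed terms, and the pointwise rules would then
  rewrite below the abstraction.\<close>

declare plus_fun_apply [simp del] zero_fun_apply [simp del] minus_apply [simp del] uminus_apply [simp del]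

lemmas vec_apply = plus_fun_apply zero_fun_apply minus_apply uminus_apply

lemma sum_fun_apply: "(\<Sum>i\<in>A. f i) x = (\<Sum>i\<in>A. f i x)"
  by (induction A rule: infinite_finite_induct) (auto simp: vec_apply)

lemma act_zero [simp]: "act a 0 = 0" by (auto simp: act_def fun_eq_iff vec_apply)
lemma act_zero_left [simp]: "act 0 x = 0" by (auto simp: act_def fun_eq_iff vec_apply)
lemma act_one [simp]: "act 1 x = x" by (auto simp: act_def fun_eq_iff vec_apply)
lemma act_act: "act a (act b x) = act (a * b) x" by (auto simp: act_def mult.assoc)
lemma act_add: "act a (x + y) = act a x + act a y" by (auto simp: act_def fun_eq_iff vec_apply algebra_simps)
lemma act_add_left: "act (a + b) x = act a x + act b x" by (auto simp: act_def fun_eq_iff vec_apply algebra_simps)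
lemma act_minus: "act a (- x) = - act a x" by (auto simp: act_def fun_eq_iff vec_apply)
lemma act_minus_left: "act (- a) x = - act a x" by (auto simp: act_def fun_eq_iff vec_apply)
lemma act_apply: "act a x i = a * x i" by (auto simp: act_def)

lemma act_sum: "act a (\<Sum>i\<in>A. f i) = (\<Sum>i\<in>A. act a (f i))"
  by (induction A rule: infinite_finite_induct) (auto simp: act_add)

lemma submod_zero: "submod M \<Longrightarrow> 0 \<in> M" by (auto simp: submod_def)
lemma submod_add: "submod M \<Longrightarrow> x \<in> M \<Longrightarrow> y \<in> M \<Longrightarrow> x + y \<in> M" by (auto simp: submod_def)
lemma submod_act: "submod M \<Longrightarrow> x \<in> M \<Longrightarrow> act a x \<in> M" by (auto simp: submod_def)
lemma submod_minus: "submod M \<Longrightarrow> x \<in> M \<Longrightarrow> - x \<in> M"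
  using submod_act[of M x "-1"] by (simp add: act_minus_left)
lemma submod_diff: "submod M \<Longrightarrow> x \<in> M \<Longrightarrow> y \<in> M \<Longrightarrow> x - y \<in> M"
  using submod_add[of M x "- y"] submod_minus by fastforce
lemma submod_sum: "submod M \<Longrightarrow> (\<And>i. i \<in> A \<Longrightarrow> f i \<in> M) \<Longrightarrow> (\<Sum>i\<in>A. f i) \<in> M"
  by (induction A rule: infinite_finite_induct) (auto simp: submod_zero submod_add)

lemma submod_zero_set [simp]: "submod {0}" by (auto simp: submod_def)
lemma submod_free [simp]: "submod (free n)" by (auto simp: submod_def free_def act_def vec_apply)

lemma lin_mem: "lin M N f \<Longrightarrow> x \<in> M \<Longrightarrow> f x \<in> N" by (auto simp: lin_def)
lemma lin_add: "lin M N f \<Longrightarrow> x \<in> M \<Longrightarrow> y \<in> M \<Longrightarrow> f (x + y) = f x + f y" by (auto simp: lin_def)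
lemma lin_act: "lin M N f \<Longrightarrow> x \<in> M \<Longrightarrow> f (act a x) = act a (f x)" by (auto simp: lin_def)
lemma lin_zero: "lin M N f \<Longrightarrow> submod M \<Longrightarrow> f 0 = 0"
  using lin_act[of M N f 0 0] submod_zero[of M] by simp
lemma lin_minus: "lin M N f \<Longrightarrow> x \<in> M \<Longrightarrow> f (- x) = - f x"
  using lin_act[of M N f x "-1"] by (simp add: act_minus_left)
lemma lin_diff: "lin M N f \<Longrightarrow> submod M \<Longrightarrow> x \<in> M \<Longrightarrow> y \<in> M \<Longrightarrow> f (x - y) = f x - f y"
  using lin_add[of M N f x "- y"] submod_minus[of M y] lin_minus[of M N f y] by simp
lemma lin_sum:
  assumes "lin M N f" "submod M" "\<And>i. i \<in> A \<Longrightarrow> g i \<in> M"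
  shows "f (\<Sum>i\<in>A. g i) = (\<Sum>i\<in>A. f (g i))"
  using assms(3)
proof (induction A rule: infinite_finite_induct)
  case (insert x F)
  then have "f (g x + sum g F) = f (g x) + f (sum g F)"
    by (intro lin_add[OF assms(1)] submod_sum[OF assms(2)]) auto
  with insert show ?case by simp
qed (auto simp: lin_zero[OF assms(1,2)])

lemma lin_comp: "lin A B f \<Longrightarrow> lin B C g \<Longrightarrow> lin A C (\<lambda>x. g (f x))" by (auto simp: lin_def)
lemma lin_const_zero: "submod B \<Longrightarrow> lin A B (\<lambda>x. 0)" by (auto simp: lin_def submod_zero)
lemma lin_plus: "lin A B f \<Longrightarrow> lin A B g \<Longrightarrow> submod B \<Longrightarrow> lin A B (\<lambda>x. f x + g x)"
  by (auto simp: lin_def submod_add act_add)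
lemma lin_uminus: "lin A B f \<Longrightarrow> submod B \<Longrightarrow> lin A B (\<lambda>x. - f x)"
  by (auto simp: lin_def submod_minus act_minus)
lemma lin_mono: "lin A B f \<Longrightarrow> A' \<subseteq> A \<Longrightarrow> B \<subseteq> B' \<Longrightarrow> lin A' B' f"
  unfolding lin_def by (simp add: subset_iff)
lemma lin_funpow: "lin A A f \<Longrightarrow> lin A A (f ^^ k)" by (induction k) (auto simp: lin_def)
lemma submod_image: "lin A B f \<Longrightarrow> submod A \<Longrightarrow> submod (f ` A)"
  unfolding submod_def[of "f ` A"]
proof (intro conjI ballI allI)
  assume f: "lin A B f" and A: "submod A"
  show "0 \<in> f ` A" using lin_zero[OF f A] submod_zero[OF A] by force
  fix x assume x: "x \<in> f ` A"
  then obtain x' where x': "x = f x'" "x' \<in> A" by auto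
  show "act a x \<in> f ` A" for a using lin_act[OF f x'(2)] submod_act[OF A x'(2)] x' by (metis imageI)
  fix y assume "y \<in> f ` A"
  then obtain y' where y': "y = f y'" "y' \<in> A" by auto
  show "x + y \<in> f ` A" using lin_add[OF f x'(2) y'(2)] submod_add[OF A x'(2) y'(2)] x' y' by (metis imageI)
qed

lemma submod_kernel: "lin A B f \<Longrightarrow> submod A \<Longrightarrow> submod {x \<in> A. f x = 0}"
  unfolding submod_def[of "{x \<in> A. f x = 0}"]
  by (auto simp: lin_zero lin_add lin_act submod_zero submod_add submod_act)

section \<open>Left ideals and the Jacobson radical\<close>

lemma left_ideal_zero: "left_ideal L \<Longrightarrow> 0 \<in> L" by (auto simp: left_ideal_def)
lemma left_ideal_add: "left_ideal L \<Longrightarrow> x \<in> L \<Longrightarrow> y \<in> L \<Longrightarrow> x + y \<in> L" by (auto simp: left_ideal_def)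
lemma left_ideal_mult: "left_ideal L \<Longrightarrow> x \<in> L \<Longrightarrow> a * x \<in> L" by (auto simp: left_ideal_def)
lemma left_ideal_minus: "left_ideal L \<Longrightarrow> x \<in> L \<Longrightarrow> - x \<in> L"
  using left_ideal_mult[of L x "-1"] by simp
lemma left_ideal_diff: "left_ideal L \<Longrightarrow> x \<in> L \<Longrightarrow> y \<in> L \<Longrightarrow> x - y \<in> L"
  using left_ideal_add[of L x "- y"] left_ideal_minus by fastforce

lemma left_ideal_plus: "left_ideal A \<Longrightarrow> left_ideal B \<Longrightarrow> left_ideal {a + b | a b. a \<in> A \<and> b \<in> B}"
  unfolding left_ideal_def[of "{a + b | a b. a \<in> A \<and> b \<in> B}"]
proof (intro conjI ballI allI)
  assume A: "left_ideal A" and B: "left_ideal B"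
  show "0 \<in> {a + b |a b. a \<in> A \<and> b \<in> B}" using left_ideal_zero[OF A] left_ideal_zero[OF B] by force
  fix x assume "x \<in> {a + b |a b. a \<in> A \<and> b \<in> B}"
  then obtain a b where ab: "x = a + b" "a \<in> A" "b \<in> B" by auto
  show "c * x \<in> {a + b |a b. a \<in> A \<and> b \<in> B}" for c
    using left_ideal_mult[OF A ab(2), of c] left_ideal_mult[OF B ab(3), of c] ab(1)
    by (auto simp: algebra_simps)
  fix y assume "y \<in> {a + b |a b. a \<in> A \<and> b \<in> B}"
  then obtain a' b' where ab': "y = a' + b'" "a' \<in> A" "b' \<in> B" by auto
  have "x + y = (a + a') + (b + b')" by (simp add: ab ab')
  then show "x + y \<in> {a + b |a b. a \<in> A \<and> b \<in> B}"
    using left_ideal_add[OF A ab(2) ab'(2)] left_ideal_add[OF B ab(3) ab'(3)] by blast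
qed

lemma maximal_left_ideal_sum:
  assumes m: "maximal_left_ideal m" and A: "left_ideal A" and "\<not> A \<subseteq> m"
  shows "\<exists>a\<in>A. 1 - a \<in> m"
proof -
  define S where "S = {a + b | a b. a \<in> A \<and> b \<in> m}"
  have lm: "left_ideal m" using m by (simp add: maximal_left_ideal_def)
  have S: "left_ideal S" unfolding S_def using left_ideal_plus[OF A lm] .
  have mS: "m \<subseteq> S" unfolding S_def
  proof
    fix x assume "x \<in> m"
    then show "x \<in> {a + b | a b. a \<in> A \<and> b \<in> m}"
      using left_ideal_zero[OF A] by (intro CollectI exI[of _ 0] exI[of _ x]) auto
  qed
  have AS: "A \<subseteq> S" unfolding S_def
  proof
    fix x assume "x \<in> A"
    then show "x \<in> {a + b | a b. a \<in> A \<and> b \<in> m}"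
      using left_ideal_zero[OF lm] by (intro CollectI exI[of _ x] exI[of _ 0]) auto
  qed
  have "S \<noteq> m" using AS assms(3) by blast
  then have "S = UNIV" using m S mS unfolding maximal_left_ideal_def by blast
  then have "1 \<in> S" by simp
  then obtain a b where ab: "1 = a + b" "a \<in> A" "b \<in> m" unfolding S_def by auto
  then have "1 - a = b" by (simp add: algebra_simps)
  then show ?thesis using ab by auto
qed

lemma left_ideal_annihilator:
  assumes "submod N"
  shows "left_ideal {a. act a x \<in> N}"
  using assms by (auto simp: left_ideal_def submod_zero act_add_left submod_add act_act[symmetric] submod_act)

lemma left_ideal_right_quotient:
  assumes "left_ideal m"
  shows "left_ideal {x. x * b \<in> m}"
  using assms by (auto simp: left_ideal_def algebra_simps)

lemma left_ideal_UNIV: "left_ideal L \<Longrightarrow> 1 \<in> L \<Longrightarrow> L = UNIV"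
  using left_ideal_mult[of L 1] by auto

lemma left_ideal_jrad: "left_ideal (jrad TYPE('a::ring_1))"
  by (auto simp: jrad_def left_ideal_def maximal_left_ideal_def)

text \<open>For a maximal left ideal \<open>m\<close>, the set \<open>{x. x * b \<in> m}\<close>
  annihilates the class of \<open>b\<close> in the simple module modulo \<open>m\<close>, so it is
  maximal or everything. This makes the radical, defined by left ideals, two-sided.\<close>

lemma jrad_mult_right:
  fixes a b :: "'a::ring_1"
  assumes "a \<in> jrad TYPE('a)"
  shows "a * b \<in> jrad TYPE('a)"
  unfolding jrad_def
proof (intro InterI, clarify)
  fix m :: "'a set" assume m: "maximal_left_ideal m"
  then have lm: "left_ideal m" by (simp add: maximal_left_ideal_def)
  let ?L = "{x. x * b \<in> m}"
  have L: "left_ideal ?L" using left_ideal_right_quotient[OF lm] .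
  show "a * b \<in> m"
  proof (cases "?L = UNIV")
    case False
    have "L'' = ?L \<or> L'' = UNIV" if L'': "left_ideal L''" "?L \<subseteq> L''" for L''
    proof (rule disjCI)
      assume "L'' \<noteq> UNIV"
      show "L'' = ?L"
      proof (rule ccontr)
        assume "L'' \<noteq> ?L"
        then obtain x where x: "x \<in> L''" "x * b \<notin> m" using L'' by blast
        have "left_ideal {c * (x * b) | c. True}"
          unfolding left_ideal_def
          by safe (metis mult_zero_left, metis distrib_right, metis mult.assoc)
        moreover have "\<not> {c * (x * b) | c. True} \<subseteq> m" using x by (metis (mono_tags, lifting) mem_Collect_eq mult_1 subsetD)
        ultimately obtain c where "1 - c * (x * b) \<in> m" using maximal_left_ideal_sum[OF m] by blast
        \<comment> \<open>Left multiplication by \<open>b\<close> turns the element into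
          \<open>(1 - b * c * x) * b\<close>, which puts \<open>1 - b * c * x\<close> into
          \<open>?L\<close> and so into \<open>L''\<close>.\<close>
        then have "b * (1 - c * (x * b)) \<in> m" using left_ideal_mult[OF lm] by blast
        then have "(1 - b * c * x) * b \<in> m" by (simp add: algebra_simps)
        then have "1 - b * c * x \<in> L''" using L'' by blast
        moreover have "b * c * x \<in> L''" using left_ideal_mult[OF L''(1) x(1)] by blast
        ultimately have "1 \<in> L''" using left_ideal_add[OF L''(1)] by fastforce
        then show False using left_ideal_UNIV[OF L''(1)] \<open>L'' \<noteq> UNIV\<close> by blast
      qed
    qed
    then have "maximal_left_ideal ?L" using L False unfolding maximal_left_ideal_def by blast
    then show ?thesis using assms unfolding jrad_def by blast
  qed blast
qed

section \<open>Radical and socle of a module\<close>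

inductive_set jmult :: "'a::ring_1 vec set \<Rightarrow> 'a vec set" for B where
  zero: "0 \<in> jmult B"
| add: "a \<in> jrad TYPE('a) \<Longrightarrow> b \<in> B \<Longrightarrow> y \<in> jmult B \<Longrightarrow> act a b + y \<in> jmult B"

lemma act_in_jmult: "a \<in> jrad TYPE('a::ring_1) \<Longrightarrow> b \<in> B \<Longrightarrow> act a b \<in> jmult B"
  using jmult.add[of a b B 0] jmult.zero by fastforce

lemma submod_jmult [simp]: "submod (jmult B)"
proof -
  have "x + y \<in> jmult B" if "x \<in> jmult B" "y \<in> jmult B" for x y
    using that by (induction) (auto simp: add.assoc intro: jmult.add)
  moreover have "act c x \<in> jmult B" if "x \<in> jmult B" for c x
    using that
    by induction (auto simp: act_add act_act intro!: jmult.zero jmult.add left_ideal_mult[OF left_ideal_jrad])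
  ultimately show ?thesis by (auto simp: submod_def jmult.zero)
qed

lemma jmult_least:
  assumes "submod N" "\<And>a b. a \<in> jrad TYPE('a) \<Longrightarrow> b \<in> B \<Longrightarrow> act a b \<in> N"
  shows "jmult (B :: 'a::ring_1 vec set) \<subseteq> N"
proof
  fix x assume "x \<in> jmult B"
  then show "x \<in> N" by induction (auto intro: submod_zero[OF assms(1)] submod_add[OF assms(1)] assms(2))
qed

lemma jmult_subset: "submod B \<Longrightarrow> jmult B \<subseteq> B"
  by (rule jmult_least) (auto simp: submod_act)

text \<open>\<open>C\<close> may be smaller than the codomain, so a map with image in a radical
  layer or in the socle can be pushed one layer deeper.\<close>

lemma lin_jmult:
  assumes "lin A B f" "submod A" "\<And>x. x \<in> A \<Longrightarrow> f x \<in> C" "x \<in> jmult A"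
  shows "f x \<in> jmult C"
  using assms(4)
proof induction
  case zero
  then show ?case using lin_zero[OF assms(1,2)] jmult.zero by metis
next
  case (add a b y)
  have "y \<in> A" using add.hyps jmult_subset[OF assms(2)] by blast
  then have "f (act a b + y) = act a (f b) + f y"
    using lin_add[OF assms(1), of "act a b" y] lin_act[OF assms(1), of b a] submod_act[OF assms(2)] add.hyps
    by metis
  then show ?case using jmult.add[OF add.hyps(1) assms(3)] add by metis
qed

lemma jmult_image: "lin A B f \<Longrightarrow> submod A \<Longrightarrow> jmult (f ` A) \<subseteq> f ` jmult A"
proof (rule jmult_least)
  assume f: "lin A B f" and A: "submod A"
  show "submod (f ` jmult A)"
    using submod_image[OF lin_mono[OF f jmult_subset[OF A] order_refl]] by simp
  fix a b assume a: "a \<in> jrad TYPE('a)" "b \<in> f ` A"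
  then obtain b' where "b = f b'" "b' \<in> A" by blast
  then show "act a b \<in> f ` jmult A" using lin_act[OF f, of b' a] act_in_jmult[OF a(1), of b' A] by force
qed

definition soc :: "'a::ring_1 vec set \<Rightarrow> 'a vec set" where
  "soc B = {x \<in> B. \<forall>a \<in> jrad TYPE('a). act a x = 0}"

lemma soc_subset: "soc B \<subseteq> B" by (auto simp: soc_def)

lemma submod_soc [simp]: "submod B \<Longrightarrow> submod (soc B)"
  unfolding submod_def[of "soc B"] unfolding soc_def
  by (auto simp: submod_zero submod_add submod_act act_add act_act jrad_mult_right)

lemma jmult_soc: "jmult (soc B) = {0}"
  using jmult_least[of "{0}" "soc B"] jmult.zero by (force simp: soc_def)

text \<open>A projective module given by a dual basis whose functionals are coordinates.\<close>

definition pj :: "nat set \<Rightarrow> (nat \<Rightarrow> 'a vec) \<Rightarrow> 'a::ring_1 vec set \<Rightarrow> bool" where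
  "pj I q B \<longleftrightarrow> submod B \<and> finite I \<and> (\<forall>i\<in>I. q i \<in> B) \<and> (\<forall>x\<in>B. x = (\<Sum>i\<in>I. act (x i) (q i)))"

definition proj :: "'a::ring_1 vec set \<Rightarrow> bool" where
  "proj B \<longleftrightarrow> (\<exists>I q. pj I q B)"

lemma pj_expand: "pj I q B \<Longrightarrow> x \<in> B \<Longrightarrow> x = (\<Sum>i\<in>I. act (x i) (q i))" by (simp add: pj_def)
lemma pj_mem: "pj I q B \<Longrightarrow> i \<in> I \<Longrightarrow> q i \<in> B" by (simp add: pj_def)
lemma proj_submod: "proj B \<Longrightarrow> submod B" by (auto simp: pj_def proj_def)

lemma lin_pj:
  assumes "pj I q B" "lin B C f" "x \<in> B"
  shows "f x = (\<Sum>i\<in>I. act (x i) (f (q i)))"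
proof -
  have B: "submod B" using assms(1) by (simp add: pj_def)
  have "f x = f (\<Sum>i\<in>I. act (x i) (q i))" using pj_expand[OF assms(1,3)] by simp
  also have "\<dots> = (\<Sum>i\<in>I. f (act (x i) (q i)))"
    using pj_mem[OF assms(1)] by (intro lin_sum[OF assms(2) B] submod_act[OF B]) auto
  also have "\<dots> = (\<Sum>i\<in>I. act (x i) (f (q i)))"
    using pj_mem[OF assms(1)] by (intro sum.cong lin_act[OF assms(2)]) auto
  finally show ?thesis .
qed

lemma lin_from_pj:
  assumes "submod C" "\<And>i. i \<in> I \<Longrightarrow> c i \<in> C"
  shows "lin B C (\<lambda>x. \<Sum>i\<in>I. act (x i) (c i))"
  unfolding lin_def
  by (auto intro!: submod_sum[OF assms(1)] submod_act[OF assms(1)] assms(2)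
      simp: vec_apply act_apply act_add_left sum.distrib act_sum act_act)

lemma pj_jmult: "pj I q B \<Longrightarrow> x \<in> B \<Longrightarrow> (\<And>i. i \<in> I \<Longrightarrow> x i \<in> jrad TYPE('a)) \<Longrightarrow> x \<in> jmult (B::'a::ring_1 vec set)"
  using pj_expand[of I q B x] pj_mem[of I q B] submod_sum[OF submod_jmult, of I "\<lambda>i. act (x i) (q i)" B]
  by (metis act_in_jmult)

lemma fg_proj_proj:
  assumes "proj B" shows "fg_proj B"
proof -
  obtain I q where pj: "pj I q B" using assms by (auto simp: proj_def)
  have fI: "finite I" and B: "submod B" using pj by (auto simp: pj_def)
  obtain n where n: "\<forall>i\<in>I. i < n" using finite_nat_set_iff_bounded[of I] fI by blast
  let ?f = "\<lambda>x i. if i \<in> I then x i else 0" and ?g = "\<lambda>x. \<Sum>i\<in>I. act (x i) (q i)"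
  have "lin B (free n) ?f" unfolding lin_def using n
    by (auto simp: free_def vec_apply act_apply fun_eq_iff)
  moreover have "lin (free n) B ?g" using lin_from_pj[OF B, of I q] pj_mem[OF pj] by blast
  moreover have "?g (?f x) = x" if "x \<in> B" for x
  proof -
    have "?g (?f x) = (\<Sum>i\<in>I. act (x i) (q i))" by (intro sum.cong) auto
    then show ?thesis using pj_expand[OF pj that] by simp
  qed
  ultimately show ?thesis unfolding fg_proj_def using B by blast
qed

definition unit_vec :: "nat \<Rightarrow> 'a::ring_1 vec" where
  "unit_vec i = (\<lambda>j. if j = i then 1 else 0)"

lemma pj_free: "pj {..<n} unit_vec (free n :: 'a::ring_1 vec set)"
proof -
  have "x = (\<Sum>i<n. act (x i) (unit_vec i))" if "x \<in> free n" for x :: "'a vec"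
  proof
    fix j
    have "(\<Sum>i<n. act (x i) (unit_vec i)) j = (\<Sum>i<n. if j = i then x i else 0)"
      unfolding sum_fun_apply by (intro sum.cong) (auto simp: act_apply unit_vec_def)
    also have "\<dots> = x j" using that by (simp add: free_def)
    finally show "x j = (\<Sum>i<n. act (x i) (unit_vec i)) j" by simp
  qed
  moreover have "unit_vec i \<in> (free n :: 'a vec set)" if "i < n" for i using that by (auto simp: unit_vec_def free_def)
  ultimately show ?thesis by (simp add: pj_def)
qed

lemma submod_cyclic:
  assumes D: "left_ideal D"
  shows "submod {act a y | a. a \<in> D}"
  unfolding submod_def
proof (intro conjI ballI allI)
  show "0 \<in> {act a y | a. a \<in> D}"
    using left_ideal_zero[OF D] by (intro CollectI exI[of _ 0]) auto
  fix x assume "x \<in> {act a y | a. a \<in> D}"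
  then obtain a where a: "x = act a y" "a \<in> D" by auto
  show "act c x \<in> {act a y | a. a \<in> D}" for c
    using left_ideal_mult[OF D a(2), of c] a(1) by (auto simp: act_act)
  fix z assume "z \<in> {act a y | a. a \<in> D}"
  then obtain b where b: "z = act b y" "b \<in> D" by auto
  show "x + z \<in> {act a y | a. a \<in> D}"
    using left_ideal_add[OF D a(2) b(2)] a(1) b(1) by (auto simp: act_add_left[symmetric])
qed

lemma submod_plus: 
  assumes A: "submod A" and B: "submod B"
  shows "submod {a + b | a b. a \<in> A \<and> b \<in> B}"
  unfolding submod_def
proof (intro conjI ballI allI)
  show "0 \<in> {a + b |a b. a \<in> A \<and> b \<in> B}"
    using submod_zero[OF A] submod_zero[OF B] by (intro CollectI exI[of _ 0]) auto
  fix x assume "x \<in> {a + b |a b. a \<in> A \<and> b \<in> B}"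
  then obtain a b where ab: "x = a + b" "a \<in> A" "b \<in> B" by auto
  show "act c x \<in> {a + b |a b. a \<in> A \<and> b \<in> B}" for c
    using submod_act[OF A ab(2), of c] submod_act[OF B ab(3), of c] ab(1) act_add[of c a b]
    by (intro CollectI exI[of _ "act c a"] exI[of _ "act c b"]) auto
  fix y assume "y \<in> {a + b |a b. a \<in> A \<and> b \<in> B}"
  then obtain a' b' where ab': "y = a' + b'" "a' \<in> A" "b' \<in> B" by auto
  have "x + y = (a + a') + (b + b')" by (simp add: ab ab')
  then show "x + y \<in> {a + b |a b. a \<in> A \<and> b \<in> B}"
    using submod_add[OF A ab(2) ab'(2)] submod_add[OF B ab(3) ab'(3)]
    by (intro CollectI exI[of _ "a + a'"] exI[of _ "b + b'"]) auto
qed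

section \<open>Modules over a self-injective algebra\<close>

locale self_inj_algebra =
  fixes sc :: "'k::field \<Rightarrow> 'a::ring_1 \<Rightarrow> 'a"
  assumes fd: "fd_algebra sc" and si: "self_injective TYPE('a)"
begin

abbreviation J :: "'a set" where "J \<equiv> jrad TYPE('a)"

sublocale alg: vector_space sc using fd by (simp add: fd_algebra_def)

sublocale vec: vector_space "vsc sc"
  by unfold_locales (auto simp: vsc_def vec_apply fun_eq_iff alg.scale_left_distrib alg.scale_right_distrib)

lemma sc_mult: "sc c x = sc c 1 * x"
  using fd unfolding fd_algebra_def by (metis mult_1)

lemma vsc_act: "vsc sc c v = act (sc c 1) v"
  by (auto simp: vsc_def act_def sc_mult[symmetric])

lemma subspace_submod: "submod M \<Longrightarrow> vec.subspace M"
  by (auto simp: vec.subspace_def vsc_act submod_zero submod_add submod_act)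

lemma subspace_left_ideal: "left_ideal L \<Longrightarrow> alg.subspace L"
  unfolding alg.subspace_def using sc_mult left_ideal_mult left_ideal_zero left_ideal_add by metis

definition basis :: "'a set" where "basis = (SOME S. finite S \<and> alg.span S = UNIV)"

lemma finite_basis: "finite basis" and span_basis: "alg.span basis = UNIV"
  using someI_ex[of "\<lambda>S. finite S \<and> alg.span S = UNIV"] fd
  unfolding basis_def fd_algebra_def by auto

definition fdm :: "'a vec set \<Rightarrow> bool" where
  "fdm M \<longleftrightarrow> submod M \<and> (\<exists>S. finite S \<and> M \<subseteq> vec.span S)"

lemma fdm_submod: "fdm M \<Longrightarrow> submod M" by (simp add: fdm_def)
lemma fdm_subset: "fdm M \<Longrightarrow> submod N \<Longrightarrow> N \<subseteq> M \<Longrightarrow> fdm N" by (auto simp: fdm_def)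

lemma fdm_proj:
  assumes "proj B" shows "fdm B"
proof -
  obtain I q where pj: "pj I q B" using assms by (auto simp: proj_def)
  let ?S = "(\<lambda>(s, i). act s (q i)) ` (basis \<times> I)"
  have act: "act a (q i) \<in> vec.span ?S" if "i \<in> I" for a i
  proof -
    have "a \<in> alg.span basis" using span_basis by simp
    then show ?thesis
    proof (induction rule: alg.span_induct_alt)
      case base
      then show ?case using vec.span_zero by simp
    next
      case (step c x y)
      have "act (sc c x + y) (q i) = vsc sc c (act x (q i)) + act y (q i)"
        by (simp add: act_add_left vsc_act act_act sc_mult[symmetric])
      moreover have "act x (q i) \<in> vec.span ?S" using step that by (intro vec.span_base) force
      ultimately show ?case using step vec.span_add vec.span_scale by metis
    qed
  qed
  have "x \<in> vec.span ?S" if "x \<in> B" for x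
    by (subst pj_expand[OF pj that]) (intro vec.span_sum act)
  moreover have "finite ?S" using finite_basis pj by (simp add: pj_def)
  moreover have "submod B" using pj by (simp add: pj_def)
  ultimately show ?thesis unfolding fdm_def by blast
qed

lemma fdm_minimal:
  assumes "fdm M" "Q A" "\<And>A. Q A \<Longrightarrow> submod A \<and> A \<subseteq> M"
  shows "\<exists>A. Q A \<and> (\<forall>B. Q B \<and> B \<subseteq> A \<longrightarrow> B = A)"
proof -
  obtain S where S: "finite S" "M \<subseteq> vec.span S" using assms(1) by (auto simp: fdm_def)
  show ?thesis
    by (rule vec.ex_minimal_subspace[of S Q A, OF S(1) assms(2)]) (use assms(3) S(2) subspace_submod in blast)
qed

lemma fdm_maximal:
  assumes "fdm M" "Q A" "\<And>A. Q A \<Longrightarrow> submod A \<and> A \<subseteq> M"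
  shows "\<exists>A. Q A \<and> (\<forall>B. Q B \<and> A \<subseteq> B \<longrightarrow> B = A)"
proof -
  obtain S where S: "finite S" "M \<subseteq> vec.span S" using assms(1) by (auto simp: fdm_def)
  show ?thesis
    by (rule vec.ex_maximal_subspace[of S Q A, OF S(1) assms(2)]) (use assms(3) S(2) subspace_submod in blast)
qed

lemma left_ideal_minimal:
  fixes Q :: "'a set \<Rightarrow> bool"
  assumes "Q A" "\<And>A. Q A \<Longrightarrow> left_ideal A"
  shows "\<exists>A. Q A \<and> (\<forall>B. Q B \<and> B \<subseteq> A \<longrightarrow> B = A)"
  by (rule alg.ex_minimal_subspace[of basis Q A, OF finite_basis assms(1)]) (simp add: span_basis subspace_left_ideal assms(2))

lemma left_ideal_maximal:
  fixes Q :: "'a set \<Rightarrow> bool"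
  assumes "Q A" "\<And>A. Q A \<Longrightarrow> left_ideal A"
  shows "\<exists>A. Q A \<and> (\<forall>B. Q B \<and> A \<subseteq> B \<longrightarrow> B = A)"
  by (rule alg.ex_maximal_subspace[of basis Q A, OF finite_basis assms(1)]) (simp add: span_basis subspace_left_ideal assms(2))

lemma ex_maximal_left_ideal:
  fixes L :: "'a set"
  assumes "left_ideal L" "L \<noteq> UNIV"
  shows "\<exists>m. maximal_left_ideal m \<and> L \<subseteq> m"
proof -
  obtain m where m: "left_ideal m \<and> m \<noteq> UNIV \<and> L \<subseteq> m"
    "\<forall>B. (left_ideal B \<and> B \<noteq> UNIV \<and> L \<subseteq> B) \<and> m \<subseteq> B \<longrightarrow> B = m"
    using left_ideal_maximal[of "\<lambda>m. left_ideal m \<and> m \<noteq> UNIV \<and> L \<subseteq> m" L] assms by blast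
  then have "maximal_left_ideal m" unfolding maximal_left_ideal_def by (metis order_trans)
  then show ?thesis using m by blast
qed

text \<open>For a maximal submodule \<open>N\<close> and \<open>x \<notin> N\<close>, the annihilator of \<open>x\<close> modulo \<open>N\<close> is a
  maximal left ideal.\<close>

lemma jmult_maximal_submod:
  fixes M N :: "'a vec set"
  assumes M: "submod M" and N: "submod N" "N \<subseteq> M" "N \<noteq> M"
    and max: "\<And>B. submod B \<Longrightarrow> B \<subseteq> M \<Longrightarrow> N \<subseteq> B \<Longrightarrow> B = N \<or> B = M"
  shows "jmult M \<subseteq> N"
proof (rule jmult_least[OF N(1)])
  fix a x assume a: "a \<in> J" and x: "x \<in> M"
  show "act a x \<in> N"
  proof (cases "x \<in> N")
    case True
    then show ?thesis using submod_act[OF N(1)] by blast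
  next
    case False
    let ?L = "{a. act a x \<in> N}"
    have L: "left_ideal ?L" using left_ideal_annihilator[OF N(1)] .
    have "1 \<notin> ?L" using False by simp
    have "L' = ?L \<or> L' = UNIV" if L': "left_ideal L'" "?L \<subseteq> L'" for L'
    proof (cases "L' = ?L")
      case False
      then obtain c where c: "c \<in> L'" "act c x \<notin> N" using L' by blast
      define B where "B = {n + y | n y. n \<in> N \<and> y \<in> {act d (act c x) | d. d \<in> UNIV}}"
      have "submod B" unfolding B_def
        by (intro submod_plus N submod_cyclic) (simp add: left_ideal_def)
      moreover have "B \<subseteq> M" unfolding B_def
        using N(2) submod_add[OF M] submod_act[OF M] x by (auto simp: subset_iff)
      moreover have "N \<subseteq> B" unfolding B_def
      proof
        fix n assume "n \<in> N"
        then show "n \<in> {n + y | n y. n \<in> N \<and> y \<in> {act d (act c x) | d. d \<in> UNIV}}"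
          by (intro CollectI exI[of _ n] exI[of _ 0]) (auto intro: exI[of _ 0])
      qed
      moreover have "act c x \<in> B" unfolding B_def
        using submod_zero[OF N(1)]
        by (intro CollectI exI[of _ 0] exI[of _ "act c x"]) (auto intro: exI[of _ 1])
      ultimately have "x \<in> B" using max c(2) x by blast
      then have "\<exists>n y. x = n + y \<and> n \<in> N \<and> y \<in> {act d (act c x) | d. d \<in> UNIV}"
        unfolding B_def by (rule CollectD)
      then obtain n y where ny: "x = n + y" "n \<in> N" "y \<in> {act d (act c x) | d. d \<in> UNIV}"
        by (elim exE conjE)
      from ny(3) obtain d where "y = act d (act c x)" by (elim CollectE exE conjE)
      with ny have nd: "x = n + act d (act c x)" "n \<in> N" by simp_all
      have "act (1 - d * c) x = x - act d (act c x)"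
        using act_add_left[of 1 "- (d * c)" x] by (simp add: act_minus_left act_act)
      also have "\<dots> = n" using nd(1) by (metis add_diff_cancel_right')
      finally have "1 - d * c \<in> L'" using nd(2) L'(2) by blast
      moreover have "d * c \<in> L'" using left_ideal_mult[OF L'(1) c(1)] .
      ultimately have "1 \<in> L'" using left_ideal_add[OF L'(1)] by fastforce
      then show ?thesis using left_ideal_UNIV[OF L'(1)] by blast
    qed simp
    then have "maximal_left_ideal ?L" using L \<open>1 \<notin> ?L\<close> unfolding maximal_left_ideal_def by blast
    then show ?thesis using a unfolding jrad_def by blast
  qed
qed

section \<open>Nakayama's lemma, radical series and socle\<close>

lemma nakayama:
  assumes "fdm M" "M \<noteq> {0}"
  shows "jmult M \<noteq> M"
proof -
  have M: "submod M" using assms(1) fdm_submod by blast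
  obtain N where N: "submod N \<and> N \<subseteq> M \<and> N \<noteq> M"
    "\<forall>B. (submod B \<and> B \<subseteq> M \<and> B \<noteq> M) \<and> N \<subseteq> B \<longrightarrow> B = N"
    using fdm_maximal[OF assms(1), of "\<lambda>N. submod N \<and> N \<subseteq> M \<and> N \<noteq> M" "{0}"] assms(2) submod_zero[OF M]
    by auto
  have "jmult M \<subseteq> N" using jmult_maximal_submod[OF M] N by blast
  then show ?thesis using N(1) by blast
qed

lemma submod_jmult_funpow:
  fixes M :: "'a vec set"
  shows "submod M \<Longrightarrow> submod ((jmult ^^ k) M)"
  by (cases k) auto

lemma jmult_funpow_subset:
  fixes M :: "'a vec set"
  shows "submod M \<Longrightarrow> (jmult ^^ k) M \<subseteq> M"
proof (induction k)
  case (Suc k)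
  then show ?case using jmult_subset[OF submod_jmult_funpow[of M k]] by auto
qed simp

text \<open>A minimal term of the radical series equals its own radical and vanishes by Nakayama;
  nilpotency of \<open>J\<close> is thus obtained module by module.\<close>

lemma ex_jmult_funpow_zero:
  assumes "fdm M" shows "\<exists>k. (jmult ^^ k) M = {0}"
proof -
  have M: "submod M" using assms fdm_submod by blast
  obtain N where N: "\<exists>k. N = (jmult ^^ k) M"
    "\<forall>B. (\<exists>k. B = (jmult ^^ k) M) \<and> B \<subseteq> N \<longrightarrow> B = N"
  proof -
    have "\<exists>k. M = (jmult ^^ k) M" by (intro exI[of _ 0]) simp
    moreover have "submod A \<and> A \<subseteq> M" if "\<exists>k. A = (jmult ^^ k) M" for A
      using that submod_jmult_funpow[OF M] jmult_funpow_subset[OF M] by auto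
    ultimately show ?thesis
      using fdm_minimal[OF assms, where Q = "\<lambda>N. \<exists>k. N = (jmult ^^ k) M"] that by (smt (verit))
  qed
  then obtain k where k: "N = (jmult ^^ k) M" by blast
  have sN: "submod N" using k submod_jmult_funpow[OF M] by simp
  have "jmult N = (jmult ^^ Suc k) M" using k by simp
  then have "jmult N = N" using N(2) jmult_subset[OF sN] by blast
  moreover have "fdm N" using fdm_subset[OF assms sN] k jmult_funpow_subset[OF M] by simp
  ultimately show ?thesis using nakayama k by metis
qed

text \<open>The last nonzero term of the radical series is killed by \<open>J\<close>.\<close>

lemma soc_nonzero:
  assumes "fdm M" "M \<noteq> {0}" shows "\<exists>x\<in>soc M. x \<noteq> 0"
proof -
  have M: "submod M" using assms fdm_submod by blast
  define k where "k = (LEAST k. (jmult ^^ k) M = {0})"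
  have k: "(jmult ^^ k) M = {0}" unfolding k_def using LeastI_ex[OF ex_jmult_funpow_zero[OF assms(1)]] .
  with assms(2) obtain j where j: "k = Suc j" by (cases k) auto
  then have "(jmult ^^ j) M \<noteq> {0}" using not_less_Least[of j "\<lambda>k. (jmult ^^ k) M = {0}"] unfolding k_def by simp
  then obtain x where x: "x \<in> (jmult ^^ j) M" "x \<noteq> 0" using submod_zero[OF submod_jmult_funpow[OF M]] by blast
  have "act a x = 0" if "a \<in> J" for a using act_in_jmult[OF that x(1)] k j by simp
  then have "x \<in> soc M" using x jmult_funpow_subset[OF M, of j] by (auto simp: soc_def)
  then show ?thesis using x by blast
qed

text \<open>A left ideal \<open>D\<close> minimal with \<open>D \<not>\<subseteq> m\<close> realises the simple module \<open>\<Lambda>/m\<close> as a quotient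
  whose kernel lies in the radical; this replaces the semisimplicity of \<open>\<Lambda>/J\<close>.\<close>

lemma ex_left_ideal_complement:
  assumes m: "maximal_left_ideal m"
  shows "\<exists>D. left_ideal D \<and> \<not> D \<subseteq> m \<and> D \<inter> m \<subseteq> J"
proof -
  have lm: "left_ideal m" using m by (simp add: maximal_left_ideal_def)
  have "left_ideal (UNIV :: 'a set)" by (simp add: left_ideal_def)
  moreover have "\<not> UNIV \<subseteq> m" using m by (auto simp: maximal_left_ideal_def)
  ultimately obtain D where D: "left_ideal D \<and> \<not> D \<subseteq> m"
    "\<forall>B. (left_ideal B \<and> \<not> B \<subseteq> m) \<and> B \<subseteq> D \<longrightarrow> B = D"
    using left_ideal_minimal[of "\<lambda>D. left_ideal D \<and> \<not> D \<subseteq> m" UNIV] by blast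
  have "D \<inter> m \<subseteq> m'" if m': "maximal_left_ideal m'" for m'
  proof (rule ccontr)
    assume neg: "\<not> D \<inter> m \<subseteq> m'"
    have lm': "left_ideal m'" using m' by (simp add: maximal_left_ideal_def)
    have "left_ideal (D \<inter> m)" using D(1) lm by (auto simp: left_ideal_def)
    then obtain a where a: "a \<in> D \<inter> m" "1 - a \<in> m'" using maximal_left_ideal_sum[OF m' _ neg] by blast
    obtain d where d: "d \<in> D" "d \<notin> m" using D(1) by blast
    have "left_ideal (D \<inter> m')" using D(1) lm' by (auto simp: left_ideal_def)
    moreover have "D \<inter> m' \<noteq> D" using neg by blast
    \<comment> \<open>\<open>D \<inter> m'\<close> is strictly smaller than \<open>D\<close>, so
      minimality puts it inside \<open>m\<close>. Then both parts of
      \<open>d = (d - d * a) + d * a\<close> lie in \<open>m\<close>.\<close>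
    ultimately have sub: "D \<inter> m' \<subseteq> m" using D(2) by blast
    have da: "d * a \<in> D \<inter> m" using a left_ideal_mult D(1) lm by blast
    have "d - d * a \<in> D" using left_ideal_diff D(1) d(1) da by blast
    moreover have "d - d * a \<in> m'"
      using left_ideal_mult[OF lm' a(2), of d] by (simp add: algebra_simps)
    ultimately have "d - d * a \<in> m" using sub by blast
    then have "d \<in> m" using left_ideal_add[OF lm, of "d - d * a" "d * a"] da by simp
    then show False using d by blast
  qed
  then show ?thesis using D(1) unfolding jrad_def by blast
qed

text \<open>Supplies a simple submodule \<open>D y\<close> of the socle that meets \<open>N\<close>
  only in 0: elements of \<open>D\<close> carrying \<open>y\<close> into \<open>N\<close> lie in a
  maximal left ideal \<open>m\<close> with \<open>D \<inter> m\<close> inside \<open>J\<close>, and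
  \<open>J\<close> kills \<open>y\<close>.\<close>

lemma ex_left_ideal_avoiding:
  fixes N :: "'a vec set"
  assumes N: "submod N" "y \<notin> N" and y: "\<And>a. a \<in> J \<Longrightarrow> act a y = 0"
  shows "\<exists>D. left_ideal D \<and> (\<exists>a\<in>D. act a y \<notin> N) \<and> (\<forall>a\<in>D. act a y \<in> N \<longrightarrow> act a y = 0)"
proof -
  let ?A = "{a. act a y \<in> N}"
  have "1 \<notin> ?A" using N by simp
  then obtain m where m: "maximal_left_ideal m" "?A \<subseteq> m"
    using ex_maximal_left_ideal[OF left_ideal_annihilator[OF N(1), of y]] by blast
  obtain D where "left_ideal D" "\<not> D \<subseteq> m" "D \<inter> m \<subseteq> J" using ex_left_ideal_complement[OF m(1)] by blast
  then show ?thesis using m(2) y by blast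
qed

section \<open>Extension of maps and the socle criterion for radical maps\<close>

lemma extend_lin:
  fixes M N B' :: "'a vec set"
  assumes B': "proj B'" and M: "submod M" "submod N" "N \<subseteq> M" and f: "lin N B' f"
  shows "\<exists>g. lin M B' g \<and> (\<forall>x\<in>N. g x = f x)"
proof -
  obtain I q where pj: "pj I q B'" using B' by (auto simp: proj_def)
  \<comment> \<open>Self-injectivity concerns maps into the ring, so the coordinates are extended
    one by one and reassembled with the dual basis.\<close>
  have "\<exists>g. lin_to_ring M g \<and> (\<forall>x\<in>N. g x = f x i)" for i
  proof -
    have "lin_to_ring N (\<lambda>x. f x i)" using f by (auto simp: lin_to_ring_def lin_def vec_apply act_apply)
    then show ?thesis using si M unfolding self_injective_def by blast
  qed
  then obtain G where G: "\<And>i. lin_to_ring M (G i)" "\<And>i x. x \<in> N \<Longrightarrow> G i x = f x i" by metis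
  let ?g = "\<lambda>x. \<Sum>i\<in>I. act (G i x) (q i)"
  have sB: "submod B'" using B' proj_submod by blast
  have "lin M B' ?g" unfolding lin_def
    using G(1) pj_mem[OF pj]
    by (auto intro!: submod_sum[OF sB] submod_act[OF sB]
        simp: lin_to_ring_def act_add_left sum.distrib act_sum act_act)
  moreover have "?g x = f x" if "x \<in> N" for x
    using pj_expand[OF pj lin_mem[OF f that]] G(2)[OF that] by simp
  ultimately show ?thesis by blast
qed

text \<open>\<open>f\<close> is injective on a simple piece of the socle that avoids its kernel, and
  the inverse on the image extends to \<open>B'\<close>. The resulting fixed point of
  \<open>g\<close> after \<open>f\<close> is what the nilpotence arguments contradict.\<close>

lemma ex_partial_inverse:
  fixes B B' :: "'a vec set"
  assumes B: "proj B" and B': "submod B'" and f: "lin B B' f" and y: "y \<in> soc B" "f y \<noteq> 0"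
  shows "\<exists>g z. lin B' B g \<and> z \<in> soc B \<and> z \<noteq> 0 \<and> g (f z) = z"
proof -
  have sB: "submod B" using B proj_submod by blast
  have yB: "y \<in> B" using y soc_subset by blast
  let ?N = "{x \<in> B. f x = 0}"
  have "y \<notin> ?N" "\<And>a. a \<in> J \<Longrightarrow> act a y = 0" using y by (auto simp: soc_def)
  then obtain D where D: "left_ideal D" "\<exists>a\<in>D. act a y \<notin> ?N" "\<forall>a\<in>D. act a y \<in> ?N \<longrightarrow> act a y = 0"
    using ex_left_ideal_avoiding[OF submod_kernel[OF f sB], of y] by blast
  define E where "E = {act a y | a. a \<in> D}"
  have E: "submod E" unfolding E_def using submod_cyclic[OF D(1)] .
  have EB: "E \<subseteq> B" unfolding E_def using submod_act[OF sB yB] by auto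
  have EN: "e = 0" if "e \<in> E" "f e = 0" for e using that D(3) submod_act[OF sB yB] unfolding E_def by auto
  have fE: "lin E B' f" using lin_mono[OF f EB order_refl] .
  have inj: "inj_on f E"
  proof (rule inj_onI)
    fix u v assume uv: "u \<in> E" "v \<in> E" "f u = f v"
    then have d: "u - v \<in> E" using submod_diff[OF E] by blast
    have "f (u - v) = 0" using lin_diff[OF fE E uv(1,2)] uv(3) by simp
    then have "u - v = 0" using d EN by blast
    then show "u = v" by simp
  qed
  let ?h = "inv_into E f"
  have h: "?h (f u) = u" if "u \<in> E" for u using inv_into_f_f[OF inj that] .
  have hlin: "lin (f ` E) B ?h" unfolding lin_def
  proof (intro conjI ballI allI)
    fix x assume "x \<in> f ` E"
    then obtain u where u: "x = f u" "u \<in> E" by blast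
    show "?h x \<in> B" using h[OF u(2)] u EB by auto
    have "?h (f (act a u)) = act a u" for a using h submod_act[OF E u(2)] by blast
    then show "?h (act a x) = act a (?h x)" for a using lin_act[OF fE u(2)] h[OF u(2)] u(1) by metis
    fix y assume "y \<in> f ` E"
    then obtain v where v: "y = f v" "v \<in> E" by blast
    have "?h (f (u + v)) = u + v" using h submod_add[OF E u(2) v(2)] by blast
    then show "?h (x + y) = ?h x + ?h y"
      using lin_add[OF fE u(2) v(2)] h[OF u(2)] h[OF v(2)] u(1) v(1) by metis
  qed
  have "f ` E \<subseteq> B'" using lin_mem[OF fE] by (rule image_subsetI)
  have "\<exists>g. lin B' B g \<and> (\<forall>x\<in>f ` E. g x = ?h x)"
    by (rule extend_lin[OF B B' submod_image[OF fE E] \<open>f ` E \<subseteq> B'\<close> hlin])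
  then obtain g where g: "lin B' B g" "\<forall>x\<in>f ` E. g x = ?h x" by (elim exE conjE)
  obtain a where a: "a \<in> D" "act a y \<notin> ?N" using D(2) by blast
  let ?z = "act a y"
  have zE: "?z \<in> E" using a by (auto simp: E_def)
  have "g (f ?z) = ?z" using g(2) h[OF zE] zE by simp
  moreover have "?z \<noteq> 0" using a submod_zero[OF submod_kernel[OF f sB]] by metis
  moreover have "?z \<in> soc B" using submod_act[OF submod_soc[OF sB]] y by blast
  ultimately show ?thesis using g(1) by blast
qed

lemma jmult_funpow_shift:
  fixes B :: "'a vec set"
  assumes B: "submod B" and h: "lin B B h"
    and j: "\<And>x. x \<in> (jmult ^^ j) B \<Longrightarrow> h x \<in> (jmult ^^ Suc j) B"
  shows "x \<in> (jmult ^^ (i + j)) B \<Longrightarrow> h x \<in> (jmult ^^ Suc (i + j)) B"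
proof (induction i arbitrary: x)
  case 0
  then show ?case using j by simp
next
  case (Suc i)
  have l: "lin ((jmult ^^ (i + j)) B) B h"
    using lin_mono[OF h jmult_funpow_subset[OF B] order_refl] .
  have "h x \<in> jmult ((jmult ^^ Suc (i + j)) B)"
    by (rule lin_jmult[OF l submod_jmult_funpow[OF B] Suc.IH]) (use Suc.prems in auto)
  then show ?case by simp
qed

text \<open>A fixed point slides down the radical series, which ends at zero. The offset
  \<open>j\<close> serves maps that are controlled only on \<open>J B\<close>.\<close>

lemma fixpoint_zero:
  fixes B :: "'a vec set"
  assumes B: "fdm B" and h: "lin B B h"
    and j: "\<And>x. x \<in> (jmult ^^ j) B \<Longrightarrow> h x \<in> (jmult ^^ Suc j) B"
    and z: "z \<in> (jmult ^^ j) B" "h z = z"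
  shows "z = 0"
proof -
  have sB: "submod B" using B fdm_submod by blast
  have mem: "z \<in> (jmult ^^ (i + j)) B" for i
  proof (induction i)
    case (Suc i)
    then show ?case using jmult_funpow_shift[OF sB h j Suc.IH] z(2) by simp
  qed (simp add: z)
  obtain k where k: "(jmult ^^ k) B = {0}" using ex_jmult_funpow_zero[OF B] by blast
  have "z \<in> (jmult ^^ j) ((jmult ^^ k) B)" using mem[of k] by (simp add: funpow_add add.commute[of k])
  then show ?thesis using jmult_funpow_subset[of "{0}" j] k by auto
qed

text \<open>Otherwise a partial inverse \<open>g\<close> would make \<open>g\<close> after
  \<open>f\<close> a radical endomorphism with a nonzero fixed point.\<close>

lemma radical_kills_soc:
  fixes B B' :: "'a vec set"
  assumes B: "proj B" and B': "proj B'" and f: "lin B B' f"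
    and rad: "\<And>x. x \<in> B \<Longrightarrow> f x \<in> jmult B'" and y: "y \<in> soc B"
  shows "f y = 0"
proof (rule ccontr)
  assume "f y \<noteq> 0"
  then obtain g z where g: "lin B' B g" "z \<in> soc B" "z \<noteq> 0" "g (f z) = z"
    using ex_partial_inverse[OF B proj_submod[OF B'] f y] by blast
  have "g (f x) \<in> jmult B" if "x \<in> B" for x
    by (rule lin_jmult[OF g(1) proj_submod[OF B'] lin_mem[OF g(1)] rad[OF that]])
  then have "z = 0"
    using fixpoint_zero[OF fdm_proj[OF B] lin_comp[OF f g(1)], of 0 z] g soc_subset[of B] by auto
  then show False using g by blast
qed

text \<open>A Fitting argument: the kernels of right multiplication by powers of \<open>h\<close>
  become stationary at some \<open>k\<close>. If \<open>h ^ Suc k\<close> were nonzero, its left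
  ideal would contain a nonzero socle element; one more factor \<open>h\<close> kills it, so by
  stationarity it was already zero.\<close>

lemma right_annihilator_soc_nilpotent:
  fixes h :: 'a
  assumes "\<And>x. (\<And>a. a \<in> J \<Longrightarrow> a * x = 0) \<Longrightarrow> x * h = 0"
  shows "\<exists>k. h ^ k = 0"
proof -
  let ?K = "\<lambda>k. {x. x * h ^ k = 0}"
  have li: "left_ideal (?K k)" for k
    by (auto simp: left_ideal_def distrib_right mult.assoc)
  have "\<exists>A. (\<exists>k. A = ?K k) \<and> (\<forall>B. (\<exists>k. B = ?K k) \<and> A \<subseteq> B \<longrightarrow> B = A)"
    by (rule left_ideal_maximal[where A = "?K 0"], rule exI[of _ 0]) (use li in auto)
  then obtain k where k: "\<And>j. ?K k \<subseteq> ?K j \<Longrightarrow> ?K j = ?K k" by blast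
  have le: "?K k \<subseteq> ?K (k + i)" for i
    by (auto simp: power_add mult.assoc[symmetric])
  \<comment> \<open>The left ideal generated by \<open>h ^ Suc k\<close> is realised in coordinate 0
    of \<open>free 1\<close>, so that \<open>soc_nonzero\<close> applies.\<close>
  let ?v = "act (h ^ Suc k) (unit_vec 0)"
  have v0: "?v 0 = h ^ Suc k" by (simp add: act_apply unit_vec_def)
  let ?M = "{act a ?v | a. a \<in> UNIV}"
  have sM: "submod ?M" by (rule submod_cyclic) (simp add: left_ideal_def)
  have "?v \<in> free 1" by (auto simp: free_def act_apply unit_vec_def)
  then have "?M \<subseteq> free 1" using submod_act[OF submod_free] by auto
  then have fM: "fdm ?M" using fdm_subset[OF fdm_proj sM] pj_free proj_def by blast
  have "?M = {0}"
  proof (rule ccontr)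
    assume "?M \<noteq> {0}"
    then obtain x where x: "x \<in> soc ?M" "x \<noteq> 0" using soc_nonzero[OF fM] by blast
    then obtain a where a: "x = act a ?v" unfolding soc_def by blast
    have "b * (a * h ^ Suc k) = 0" if "b \<in> J" for b
    proof -
      have "act b x = 0" using x(1) that by (simp add: soc_def)
      then have "act b x 0 = 0" by (simp add: zero_fun_apply)
      then show ?thesis by (simp add: a act_apply unit_vec_def)
    qed
    then have "a * h ^ Suc k * h = 0" using assms by blast
    then have "a \<in> ?K (k + 2)" by (simp add: mult.assoc power_commutes)
    then have "a \<in> ?K k" using k[OF le] by blast
    then have "a * h ^ Suc k = 0" by (simp add: power_Suc2 mult.assoc[symmetric] del: power_Suc)
    then have "x = 0" by (simp add: a act_act)
    then show False using x by blast
  qed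
  moreover have "?v \<in> ?M" by (auto intro: exI[of _ 1])
  ultimately have "?v = 0" by blast
  then show ?thesis using v0 by (metis zero_fun_apply)
qed

text \<open>If \<open>c\<close> is outside a maximal \<open>m\<close>, then \<open>1 - a * c\<close>
  is in \<open>m\<close> for some \<open>a\<close>. The left socle is closed under right
  multiplication, so \<open>a * c\<close> annihilates it too and is nilpotent; the telescoping
  powers then put 1 into \<open>m\<close>.\<close>

lemma right_annihilator_soc:
  fixes c :: 'a
  assumes "\<And>x. (\<And>a. a \<in> J \<Longrightarrow> a * x = 0) \<Longrightarrow> x * c = 0"
  shows "c \<in> J"
  unfolding jrad_def
proof (intro InterI, clarify, rule ccontr)
  fix m :: "'a set" assume m: "maximal_left_ideal m" and c: "c \<notin> m"
  have lm: "left_ideal m" using m by (simp add: maximal_left_ideal_def)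
  have "left_ideal {a * c | a. True}" unfolding left_ideal_def
    by safe (metis mult_zero_left, metis distrib_right, metis mult.assoc)
  moreover have "\<not> {a * c | a. True} \<subseteq> m" using c by (metis (mono_tags, lifting) mem_Collect_eq mult_1 subsetD)
  ultimately obtain a where a: "1 - a * c \<in> m" using maximal_left_ideal_sum[OF m] by blast
  have "x * (a * c) = 0" if "\<And>b. b \<in> J \<Longrightarrow> b * x = 0" for x
    using assms[of "x * a"] that by (simp add: mult.assoc[symmetric])
  then obtain k where k: "(a * c) ^ k = 0" using right_annihilator_soc_nilpotent by blast
  have "1 - (a * c) ^ i \<in> m" for i
  proof (induction i)
    case 0
    then show ?case using left_ideal_zero[OF lm] by simp
  next
    case (Suc i)
    have "1 - (a * c) ^ Suc i = (1 - a * c) + a * c * (1 - (a * c) ^ i)" by (simp add: algebra_simps)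
    then show ?case using left_ideal_add[OF lm a left_ideal_mult[OF lm Suc.IH]] by metis
  qed
  from this[of k] have "m = UNIV" using k left_ideal_UNIV[OF lm] by simp
  then show False using c by blast
qed

text \<open>Converse of \<open>radical_kills_soc\<close>: an element \<open>u\<close> of the left
  socle of the ring makes \<open>act u (q i)\<close> a socle element, so \<open>u\<close> times each
  coordinate of \<open>f (q i)\<close> vanishes, and these coordinates lie in
  \<open>J\<close>.\<close>

lemma radical_if_kills_soc:
  fixes B B' :: "'a vec set"
  assumes B: "proj B" and B': "proj B'" and f: "lin B B' f"
    and soc: "\<And>y. y \<in> soc B \<Longrightarrow> f y = 0" and x: "x \<in> B"
  shows "f x \<in> jmult B'"
proof -
  obtain I q where pj: "pj I q B" using B by (auto simp: proj_def)
  obtain I' q' where pj': "pj I' q' B'" using B' by (auto simp: proj_def)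
  have sB: "submod B" using B proj_submod by blast
  have "f (q i) \<in> jmult B'" if i: "i \<in> I" for i
  proof (rule pj_jmult[OF pj' lin_mem[OF f pj_mem[OF pj i]]])
    fix j
    show "f (q i) j \<in> J"
    proof (rule right_annihilator_soc)
      fix u :: 'a assume u: "\<And>a. a \<in> J \<Longrightarrow> a * u = 0"
      have "act u (q i) \<in> soc B"
        using submod_act[OF sB pj_mem[OF pj i]] u by (auto simp: soc_def act_act)
      then have "act u (f (q i)) = 0" using soc lin_act[OF f pj_mem[OF pj i]] by metis
      then have "act u (f (q i)) j = 0" by (simp add: zero_fun_apply)
      then show "u * f (q i) j = 0" by (simp add: act_apply)
    qed
  qed
  then show ?thesis unfolding lin_pj[OF pj f x]
    by (intro submod_sum[OF submod_jmult] submod_act[OF submod_jmult])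
qed

text \<open>Right multiplication by \<open>b\<close> is a radical endomorphism of the free module of
  rank one and so kills its socle. This puts the left socle of the ring inside the right
  one.\<close>

lemma soc_mult_rad:
  fixes x b :: 'a
  assumes "\<And>a. a \<in> J \<Longrightarrow> a * x = 0" "b \<in> J"
  shows "x * b = 0"
proof -
  let ?f = "\<lambda>v i. v i * b"
  have P: "proj (free 1)" using pj_free proj_def by blast
  have f: "lin (free 1) (free 1) ?f"
    by (auto simp: lin_def free_def vec_apply act_apply fun_eq_iff algebra_simps)
  have "?f v \<in> jmult (free 1)" if "v \<in> free 1" for v
    using lin_mem[OF f that] by (rule pj_jmult[OF pj_free]) (rule left_ideal_mult[OF left_ideal_jrad assms(2)])
  moreover have "act x (unit_vec 0) \<in> soc (free 1)"
    using assms(1) by (auto simp: soc_def act_act free_def act_apply unit_vec_def)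
  ultimately have "?f (act x (unit_vec 0)) = 0" using radical_kills_soc[OF P P f] by blast
  then have "?f (act x (unit_vec 0)) 0 = 0" by (metis zero_fun_apply)
  then show ?thesis by (simp add: act_apply unit_vec_def)
qed

subsection \<open>Projective covers\<close>

definition soc2 :: "'a vec set \<Rightarrow> 'a vec set" where
  "soc2 B = {b \<in> B. \<forall>a\<in>J. \<forall>a'\<in>J. act a (act a' b) = 0}"

text \<open>The condition below excludes indecomposable summands of Loewy length at most \<open>2\<close>; it is
  inherited by projective covers of the socle and of the radical.\<close>

definition proj3 :: "'a vec set \<Rightarrow> bool" where
  "proj3 B \<longleftrightarrow> proj B \<and> soc2 B \<subseteq> jmult B"

text \<open>The second left socle of the ring; coordinates of elements of \<open>soc2 B\<close> lie
  in it.\<close>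

definition soc2_ring :: "'a set" where
  "soc2_ring = {t. \<forall>a\<in>J. \<forall>a'\<in>J. a * (a' * t) = 0}"

text \<open>For \<open>b\<close> in \<open>J\<close> the product \<open>b * t\<close> is in the left
  socle, hence killed by \<open>J\<close> from the right as well. So \<open>t * j\<close> is in the
  left socle, and the same passage applies to it.\<close>

lemma soc2_ring_mult_rad:
  assumes "t \<in> soc2_ring" "j \<in> J" "a \<in> J"
  shows "a * (t * j) = 0" "t * j * a = 0"
proof -
  have *: "b * (t * j) = 0" if "b \<in> J" for b
    using soc_mult_rad[of "b * t" j] assms that by (auto simp: soc2_ring_def mult.assoc)
  then show "a * (t * j) = 0" using assms by blast
  show "t * j * a = 0" using soc_mult_rad[of "t * j" a] * assms by blast
qed

definition cover :: "'a vec set \<Rightarrow> 'a vec set \<Rightarrow> ('a vec \<Rightarrow> 'a vec) \<Rightarrow> bool" where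
  "cover C M d \<longleftrightarrow> proj C \<and> lin C M d \<and> d ` C = M \<and> {x \<in> C. d x = 0} \<subseteq> jmult C"

lemma coverD:
  assumes "cover C M d"
  shows "proj C" "lin C M d" "d ` C = M" "\<And>x. x \<in> C \<Longrightarrow> d x = 0 \<Longrightarrow> x \<in> jmult C"
  using assms by (auto simp: cover_def)

lemma cover_surj: "cover C M d \<Longrightarrow> m \<in> M \<Longrightarrow> \<exists>u\<in>C. m = d u"
  using coverD(3)[of C M d] by blast

text \<open>For an element of \<open>soc2 C\<close> the coordinates lie in \<open>soc2_ring\<close>,
  so its image lies in \<open>J M\<close>, the image of \<open>J C\<close>. Correcting by an element
  of \<open>J C\<close> leaves an element of the kernel, which is also in
  \<open>J C\<close>.\<close>

lemma proj3_cover: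
  assumes c: "cover C M d" and T: "\<And>t m. t \<in> soc2_ring \<Longrightarrow> m \<in> M \<Longrightarrow> act t m \<in> jmult M"
  shows "proj3 C"
proof -
  obtain I q where pj: "pj I q C" using coverD(1)[OF c] by (auto simp: proj_def)
  have C: "submod C" using coverD(1)[OF c] proj_submod by blast
  have "x \<in> jmult C" if x: "x \<in> soc2 C" for x
  proof -
    have xC: "x \<in> C" using x by (simp add: soc2_def)
    have "x i \<in> soc2_ring" for i unfolding soc2_ring_def
    proof (intro CollectI ballI)
      fix a a' assume "a \<in> J" "a' \<in> J"
      then have "act a (act a' x) i = 0" using x by (simp add: soc2_def zero_fun_apply)
      then show "a * (a' * x i) = 0" by (simp add: act_apply)
    qed
    then have "d x \<in> jmult M" unfolding lin_pj[OF pj coverD(2)[OF c] xC]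
      using T lin_mem[OF coverD(2)[OF c]] pj_mem[OF pj] by (intro submod_sum[OF submod_jmult]) blast
    then obtain y where y: "y \<in> jmult C" "d x = d y"
      using jmult_image[OF coverD(2)[OF c] C] coverD(3)[OF c] by auto
    have yC: "y \<in> C" using y jmult_subset[OF C] by blast
    have "d (x - y) = 0" using lin_diff[OF coverD(2)[OF c] C xC yC] y by simp
    then have "x - y \<in> jmult C" using coverD(4)[OF c] submod_diff[OF C xC yC] by blast
    then show ?thesis using submod_add[OF submod_jmult _ y(1)] by fastforce
  qed
  then show ?thesis using coverD(1)[OF c] by (auto simp: proj3_def)
qed

text \<open>If a simple piece \<open>E\<close> of the socle met \<open>J^2 B\<close> trivially, the
  projection of \<open>E + J^2 B\<close> onto \<open>E\<close> would extend to an endomorphism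
  \<open>g\<close> of \<open>B\<close>. It kills \<open>J^2 B\<close>, so its image lies in
  \<open>soc2 B\<close>, hence in \<open>J B\<close>. Being radical, \<open>g\<close> kills the
  socle, yet it fixes \<open>E\<close>.\<close>

lemma proj3_soc:
  assumes "proj3 B" shows "soc B \<subseteq> jmult (jmult B)"
proof
  fix y assume y: "y \<in> soc B"
  let ?N = "jmult (jmult B)"
  have P: "proj B" using assms by (simp add: proj3_def)
  then have sB: "submod B" using proj_submod by blast
  have yB: "y \<in> B" using y soc_subset by blast
  have NB: "?N \<subseteq> B" using jmult_subset[OF sB] jmult_subset[OF submod_jmult] by blast
  show "y \<in> ?N"
  proof (rule ccontr)
    assume neg: "y \<notin> ?N"
    have "\<And>a. a \<in> J \<Longrightarrow> act a y = 0" using y by (auto simp: soc_def)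
    then obtain D where D: "left_ideal D" "\<exists>a\<in>D. act a y \<notin> ?N" "\<forall>a\<in>D. act a y \<in> ?N \<longrightarrow> act a y = 0"
      using ex_left_ideal_avoiding[OF submod_jmult neg] by blast
    define E where "E = {act a y | a. a \<in> D}"
    have E: "submod E" unfolding E_def using submod_cyclic[OF D(1)] .
    have EB: "E \<subseteq> B" unfolding E_def using submod_act[OF sB yB] by auto
    have EN: "e = 0" if "e \<in> E" "e \<in> ?N" for e using that D(3) unfolding E_def by blast
    define S where "S = {e + n | e n. e \<in> E \<and> n \<in> ?N}"
    have S: "submod S" unfolding S_def using submod_plus[OF E submod_jmult] .
    have SB: "S \<subseteq> B" unfolding S_def using EB NB submod_add[OF sB] by blast
    define h where "h = (\<lambda>s. THE e. e \<in> E \<and> s - e \<in> ?N)"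
    have h: "h (e + n) = e" if "e \<in> E" "n \<in> ?N" for e n
      unfolding h_def
    proof (rule the_equality)
      show "e \<in> E \<and> e + n - e \<in> ?N" using that by simp
      fix e' assume e': "e' \<in> E \<and> e + n - e' \<in> ?N"
      have "(e + n - e') - n = e - e'" by simp
      then have "e - e' \<in> ?N" using submod_diff[OF submod_jmult] e' that by metis
      then have "e - e' = 0" using EN submod_diff[OF E] e' that by blast
      then show "e' = e" by simp
    qed
    have "lin S B h" unfolding lin_def
    proof (intro conjI ballI allI)
      fix s assume "s \<in> S"
      then obtain e n where s: "s = e + n" "e \<in> E" "n \<in> ?N" unfolding S_def by blast
      show "h s \<in> B" using h s EB by auto
      show "h (act a s) = act a (h s)" for a
        using h[OF submod_act[OF E s(2)] submod_act[OF submod_jmult s(3)], of a a] h[OF s(2,3)]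
        by (simp add: s(1) act_add)
      fix s' assume "s' \<in> S"
      then obtain e' n' where s': "s' = e' + n'" "e' \<in> E" "n' \<in> ?N" unfolding S_def by blast
      have "s + s' = (e + e') + (n + n')" by (simp add: s s')
      then show "h (s + s') = h s + h s'"
        using h[OF submod_add[OF E s(2) s'(2)] submod_add[OF submod_jmult s(3) s'(3)]] h[OF s(2,3)] h[OF s'(2,3)]
          s(1) s'(1) by metis
    qed
    from extend_lin[OF P sB S SB this]
    obtain g where g: "lin B B g" "\<And>s. s \<in> S \<Longrightarrow> g s = h s" by blast
    have gN: "g n = 0" if "n \<in> ?N" for n
    proof -
      have "n \<in> S" unfolding S_def using submod_zero[OF E] that
        by (intro CollectI exI[of _ 0] exI[of _ n]) auto
      then show ?thesis using g(2) h[OF submod_zero[OF E] that] by simp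
    qed
    have gE: "g e = e" if "e \<in> E" for e
    proof -
      have "e \<in> S" unfolding S_def using submod_zero[OF submod_jmult] that
        by (intro CollectI exI[of _ e] exI[of _ 0]) auto
      then show ?thesis using g(2) h[OF that submod_zero[OF submod_jmult]] by simp
    qed
    have "g b \<in> jmult B" if b: "b \<in> B" for b
    proof -
      have "act a (act a' (g b)) = 0" if "a \<in> J" "a' \<in> J" for a a'
      proof -
        have "act a (act a' b) \<in> ?N" using that b by (intro act_in_jmult)
        then show ?thesis using gN lin_act[OF g(1)] b submod_act[OF sB b] by metis
      qed
      then have "g b \<in> soc2 B" using lin_mem[OF g(1) b] by (simp add: soc2_def)
      then show ?thesis using assms by (auto simp: proj3_def)
    qed
    then have kill: "g u = 0" if "u \<in> soc B" for u using radical_kills_soc[OF P P g(1) _ that] by blast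
    obtain a where a: "a \<in> D" "act a y \<notin> ?N" using D(2) by blast
    have "act a y \<in> E" using a(1) by (auto simp: E_def)
    then have "act a y = 0" using gE kill submod_act[OF submod_soc[OF sB] y] by metis
    then show False using a(2) submod_zero[OF submod_jmult] by metis
  qed
qed

lemma soc2_ring_jmult2:
  assumes t: "t \<in> soc2_ring" and x: "x \<in> jmult (jmult B)"
  shows "act t x = 0"
  using x
proof induction
  case (add a b y)
  have "act s b = 0" if "\<And>a. a \<in> J \<Longrightarrow> s * a = 0" for s
    using add.hyps(2) by induction (auto simp: act_add act_act that)
  from this[of "t * a"] have "act (t * a) b = 0" using soc2_ring_mult_rad(2)[OF t add.hyps(1)] by blast
  then show ?case using add by (simp add: act_add act_act)
qed simp

lemma proj3_soc_cover:
  assumes B: "proj3 B" and c: "cover C (soc B) d"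
  shows "proj3 C"
proof (rule proj3_cover[OF c])
  fix t m assume "t \<in> soc2_ring" "m \<in> soc B"
  then have "act t m = 0" using soc2_ring_jmult2 proj3_soc[OF B] by blast
  then show "act t m \<in> jmult (soc B)" by (simp add: jmult.zero)
qed

lemma proj3_jmult_cover:
  assumes B: "proj3 B" and c: "cover C (jmult B) d"
  shows "proj3 C"
proof (rule proj3_cover[OF c])
  fix t m assume t: "t \<in> soc2_ring" and m: "m \<in> jmult B"
  have sB: "submod B" using B proj_submod by (auto simp: proj3_def)
  from m show "act t m \<in> jmult (jmult B)"
  proof induction
    case (add a b y)
    \<comment> \<open>Here \<open>t (a b) = (t a) b\<close> with \<open>t a\<close> in the left
      socle, and the socle of \<open>B\<close> lies in \<open>J (J B)\<close>.\<close>
    have "act (t * a) b \<in> soc B"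
      using soc2_ring_mult_rad(1)[OF t add.hyps(1)] submod_act[OF sB add.hyps(2)] by (auto simp: soc_def act_act)
    then have "act (t * a) b \<in> jmult (jmult B)" using proj3_soc[OF B] by blast
    then show ?case using add submod_add[OF submod_jmult] by (simp add: act_add act_act)
  qed (simp add: jmult.zero)
qed

section \<open>Passing radicality of a chain map down a tower\<close>

lemma radical_step_soc:
  assumes B: "proj3 B" and B': "proj3 B'" and c: "cover C (soc B) d" and c': "cover C' (soc B') d'"
    and f0: "lin B B' f0" and f1: "lin C C' f1" and comm: "\<And>x. x \<in> C \<Longrightarrow> f0 (d x) = d' (f1 x)"
    and rad: "\<And>x. x \<in> C \<Longrightarrow> f1 x \<in> jmult C'" and b: "b \<in> B"
  shows "f0 b \<in> jmult B'"
proof (rule radical_if_kills_soc[OF _ _ f0 _ b])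
  show "proj B" "proj B'" using B B' by (auto simp: proj3_def)
  fix y assume "y \<in> soc B"
  then obtain x where x: "x \<in> C" "y = d x" using coverD(3)[OF c] by auto
  \<comment> \<open>The socle of \<open>B\<close> is the image of \<open>d\<close>, so
    \<open>f0\<close> sends it into \<open>J\<close> times the socle of \<open>B'\<close>, which is
    zero.\<close>
  have "d' (f1 x) \<in> jmult (soc B')"
    by (rule lin_jmult[OF coverD(2)[OF c'] proj_submod[OF coverD(1)[OF c']] lin_mem[OF coverD(2)[OF c']] rad[OF x(1)]])
  then show "f0 y = 0" using comm[OF x(1)] x(2) by (simp add: jmult_soc)
qed

text \<open>If \<open>f0\<close> is nonzero on the socle, a partial inverse \<open>g\<close> gives a
  nonzero socle element fixed by \<open>g\<close> after \<open>f0\<close>. This element lies in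
  \<open>J B\<close>, and the composite maps \<open>J B\<close> into \<open>J^2 B\<close>, so
  \<open>fixpoint_zero\<close> applies one layer down.\<close>

lemma radical_step_jmult:
  assumes B: "proj3 B" and B': "proj3 B'" and c: "cover C (jmult B) d" and c': "cover C' (jmult B') d'"
    and f0: "lin B B' f0" and f1: "lin C C' f1" and comm: "\<And>x. x \<in> C \<Longrightarrow> f0 (d x) = d' (f1 x)"
    and rad: "\<And>x. x \<in> C \<Longrightarrow> f1 x \<in> jmult C'" and b: "b \<in> B"
  shows "f0 b \<in> jmult B'"
proof (rule radical_if_kills_soc[OF _ _ f0 _ b], goal_cases)
  case (3 y)
  have P: "proj B" "proj B'" using B B' by (auto simp: proj3_def)
  have J2: "f0 x \<in> jmult (jmult B')" if xJ: "x \<in> jmult B" for x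
  proof -
    obtain u where u: "u \<in> C" "x = d u" using cover_surj[OF c xJ] by blast
    have "d' (f1 u) \<in> jmult (jmult B')"
      by (rule lin_jmult[OF coverD(2)[OF c'] proj_submod[OF coverD(1)[OF c']] lin_mem[OF coverD(2)[OF c']] rad[OF u(1)]])
    then show ?thesis using comm[OF u(1)] u(2) by simp
  qed
  show ?case
  proof (rule ccontr)
    assume "f0 y \<noteq> 0"
    then obtain g z where g: "lin B' B g" "z \<in> soc B" "z \<noteq> 0" "g (f0 z) = z"
      using ex_partial_inverse[OF P(1) proj_submod[OF P(2)] f0 3] by blast
    have 1: "g u \<in> jmult B" if "u \<in> jmult B'" for u
      by (rule lin_jmult[OF g(1) proj_submod[OF P(2)] lin_mem[OF g(1)] that])
    have g': "lin (jmult B') B g" by (rule lin_mono[OF g(1) jmult_subset[OF proj_submod[OF P(2)]] order_refl])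
    have 2: "g (f0 x) \<in> jmult (jmult B)" if "x \<in> jmult B" for x
      by (rule lin_jmult[OF g' submod_jmult 1 J2[OF that]])
    have "z \<in> jmult B"
      using g(2) proj3_soc[OF B] jmult_subset[OF submod_jmult[of B]] by blast
    then have "z = 0"
      using fixpoint_zero[OF fdm_proj[OF P(1)] lin_comp[OF f0 g(1)], of 1 z] 2 g(4) by auto
    then show False using g by blast
  qed
qed (use B B' in \<open>auto simp: proj3_def\<close>)

text \<open>Commutativity sends \<open>J B\<close> into the socle of \<open>B'\<close>, so the image
  of \<open>f0\<close> is killed by \<open>J^2\<close> and lies in \<open>soc2 B'\<close>. Here
  radicality arises with no radicality required above.\<close>

lemma radical_jmult_soc:
  assumes B: "proj3 B" and B': "proj3 B'" and c: "cover C (jmult B) d" and c': "cover C' (soc B') d'"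
    and f0: "lin B B' f0" and f1: "lin C C' f1" and comm: "\<And>x. x \<in> C \<Longrightarrow> f0 (d x) = d' (f1 x)"
    and b: "b \<in> B"
  shows "f0 b \<in> jmult B'"
proof -
  have sB: "submod B" using B proj_submod by (auto simp: proj3_def)
  have "act a (act a' (f0 b)) = 0" if a: "a \<in> J" "a' \<in> J" for a a'
  proof -
    have "act a' b \<in> jmult B" using act_in_jmult[OF a(2) b] .
    then obtain u where u: "u \<in> C" "act a' b = d u" using coverD(3)[OF c] by auto
    have "f0 (act a' b) \<in> soc B'" using comm[OF u(1)] u lin_mem[OF coverD(2)[OF c']] lin_mem[OF f1] by simp
    then show ?thesis using lin_act[OF f0 b] a by (simp add: soc_def)
  qed
  then have "f0 b \<in> soc2 B'" using lin_mem[OF f0 b] by (simp add: soc2_def)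
  then show ?thesis using B' by (auto simp: proj3_def)
qed

text \<open>On \<open>J C\<close>, \<open>f1\<close> takes values in \<open>J\<close> times the
  socle of \<open>C'\<close>, that is, zero; so \<open>f1\<close> maps \<open>C\<close> into the
  socle of \<open>C'\<close>. The radical map \<open>d'\<close> kills that socle, hence
  \<open>f0\<close> kills the socle of \<open>B\<close>.\<close>

lemma radical_step_exchange:
  assumes B: "proj3 B" and B': "proj3 B'"
    and c: "cover C (soc B) d" and e: "cover D (jmult C) e"
    and c': "cover C' (jmult B') d'" and e': "cover D' (soc C') e'"
    and f0: "lin B B' f0" and f1: "lin C C' f1" and f2: "lin D D' f2"
    and comm: "\<And>x. x \<in> C \<Longrightarrow> f0 (d x) = d' (f1 x)" "\<And>x. x \<in> D \<Longrightarrow> f1 (e x) = e' (f2 x)"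
    and rad: "\<And>x. x \<in> D \<Longrightarrow> f2 x \<in> jmult D'" and b: "b \<in> B"
  shows "f0 b \<in> jmult B'"
proof (rule radical_if_kills_soc[OF _ _ f0 _ b])
  show P: "proj B" "proj B'" using B B' by (auto simp: proj3_def)
  have sB': "submod B'" using P proj_submod by blast
  have zero: "f1 x = 0" if xJ: "x \<in> jmult C" for x
  proof -
    obtain u where u: "u \<in> D" "x = e u" using cover_surj[OF e xJ] by blast
    have "e' (f2 u) \<in> jmult (soc C')"
      by (rule lin_jmult[OF coverD(2)[OF e'] proj_submod[OF coverD(1)[OF e']] lin_mem[OF coverD(2)[OF e']] rad[OF u(1)]])
    then show ?thesis using comm(2)[OF u(1)] u(2) by (simp add: jmult_soc)
  qed
  fix y assume "y \<in> soc B"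
  then obtain x where x: "x \<in> C" "y = d x" using coverD(3)[OF c] by auto
  have "f1 x \<in> soc C'"
    using zero[OF act_in_jmult[OF _ x(1)]] lin_act[OF f1 x(1)] lin_mem[OF f1 x(1)] by (simp add: soc_def)
  moreover have "lin C' B' d'" using lin_mono[OF coverD(2)[OF c'] order_refl jmult_subset[OF sB']] .
  ultimately have "d' (f1 x) = 0"
    using radical_kills_soc[OF coverD(1)[OF c'] P(2)] lin_mem[OF coverD(2)[OF c']] by blast
  then show "f0 y = 0" using comm(1)[OF x(1)] x(2) by simp
qed

section \<open>Existence of projective covers\<close>

lemma fdm_generators:
  assumes "fdm M"
  shows "\<exists>r c. (\<forall>i<r. c i \<in> M) \<and> (\<forall>x\<in>M. \<exists>v. x = (\<Sum>i<(r::nat). act (v i) (c i)))"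
proof -
  obtain S where S: "finite S" "M \<subseteq> vec.span S" using assms by (auto simp: fdm_def)
  obtain b where b: "b \<subseteq> M" "vec.independent b" "M \<subseteq> vec.span b" "card b = vec.dim M"
    using vec.basis_exists by blast
  have fb: "finite b" using vec.independent_span_bound[OF S(1) b(2)] b(1) S(2) by blast
  obtain c where c: "bij_betw c {0..<card b} b" using ex_bij_betw_nat_finite[OF fb] by blast
  have "\<exists>v. x = (\<Sum>i<card b. act (v i) (c i))" if xM: "x \<in> M" for x
  proof -
    obtain u where u: "x = (\<Sum>y\<in>b. vsc sc (u y) y)" using b(3) xM unfolding vec.span_finite[OF fb] by blast
    also have "\<dots> = (\<Sum>i\<in>{0..<card b}. vsc sc (u (c i)) (c i))"
      using sum.reindex_bij_betw[OF c, of "\<lambda>y. vsc sc (u y) y"] by simp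
    also have "\<dots> = (\<Sum>i<card b. act (sc (u (c i)) 1) (c i))" by (simp add: vsc_act atLeast0LessThan)
    finally show ?thesis by (rule exI[of _ "\<lambda>i. sc (u (c i)) 1"])
  qed
  moreover have "\<forall>i<card b. c i \<in> M" using c b(1) unfolding bij_betw_def by auto
  ultimately show ?thesis by blast
qed

text \<open>The projective cover is found inside a free module: a submodule \<open>N\<close> minimal among those
  mapping onto \<open>M\<close> is a direct summand, because the lift \<open>\<phi>\<close> of the presentation through \<open>N\<close>
  restricts to a surjective, hence eventually bijective, endomorphism of \<open>N\<close>.\<close>

lemma ex_cover:
  assumes "fdm M" shows "\<exists>C d. cover C M d"
proof -
  have sM: "submod M" using assms fdm_submod by blast
  obtain r c where c: "\<And>i. i < r \<Longrightarrow> c i \<in> M" "\<And>x. x \<in> M \<Longrightarrow> \<exists>v. x = (\<Sum>i<(r::nat). act (v i) (c i))"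
    using fdm_generators[OF assms] by blast
  define F :: "'a vec set" where "F = free r"
  have sF: "submod F" by (simp add: F_def)
  have pF: "pj {..<r} unit_vec F" unfolding F_def by (rule pj_free)
  have fF: "fdm F" using fdm_proj pF proj_def by blast
  define p where "p = (\<lambda>v. \<Sum>i<r. act (v i) (c i))"
  have p: "lin A M p" for A unfolding p_def using lin_from_pj[OF sM, of "{..<r}" c A] c(1) by blast
  have surj: "p ` F = M"
  proof
    show "p ` F \<subseteq> M" using lin_mem[OF p] by blast
    show "M \<subseteq> p ` F"
    proof
      fix x assume "x \<in> M"
      then obtain v where v: "x = (\<Sum>i<r. act (v i) (c i))" using c(2) by blast
      let ?v = "\<lambda>i. if i < r then v i else 0"
      have "x = p ?v" unfolding v p_def by (intro sum.cong) auto
      moreover have "?v \<in> F" by (simp add: F_def free_def)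
      ultimately show "x \<in> p ` F" by blast
    qed
  qed
  have "\<exists>N. (submod N \<and> N \<subseteq> F \<and> p ` N = M) \<and>
      (\<forall>B. (submod B \<and> B \<subseteq> F \<and> p ` B = M) \<and> B \<subseteq> N \<longrightarrow> B = N)"
    by (rule fdm_minimal[OF fF, of "\<lambda>N. submod N \<and> N \<subseteq> F \<and> p ` N = M" F]) (use surj sF in auto)
  then obtain N where N: "submod N" "N \<subseteq> F" "p ` N = M"
    and min: "\<And>B. submod B \<Longrightarrow> B \<subseteq> N \<Longrightarrow> p ` B = M \<Longrightarrow> B = N" by (metis order_trans)
  have "\<forall>i. \<exists>n. i < r \<longrightarrow> n \<in> N \<and> p n = c i" using N(3) c(1) by (metis imageE)
  then obtain n where n: "\<And>i. i < r \<Longrightarrow> n i \<in> N" "\<And>i. i < r \<Longrightarrow> p (n i) = c i" by metis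
  define \<phi> where "\<phi> = (\<lambda>v. \<Sum>i<r. act (v i) (n i))"
  have \<phi>: "lin A N \<phi>" for A unfolding \<phi>_def using lin_from_pj[OF N(1), of "{..<r}" n A] n(1) by blast
  have p\<phi>: "p (\<phi> v) = p v" for v
  proof -
    have "p (\<phi> v) = (\<Sum>i<r. p (act (v i) (n i)))" unfolding \<phi>_def
      by (rule lin_sum[OF p N(1)]) (use n(1) submod_act[OF N(1)] in auto)
    also have "\<dots> = (\<Sum>i<r. act (v i) (c i))" using n lin_act[OF p, of _ N] by (intro sum.cong) auto
    finally show ?thesis by (simp add: p_def)
  qed
  have \<phi>N: "\<phi> ` N = N"
  proof (rule min[OF submod_image[OF \<phi> N(1)]])
    show "\<phi> ` N \<subseteq> N" using lin_mem[OF \<phi>] by blast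
    show "p ` \<phi> ` N = M" using N(3) by (simp add: image_image p\<phi>)
  qed
  have \<phi>kN: "(\<phi> ^^ k) ` N = N" for k
  proof (induction k)
    case (Suc k)
    have "(\<phi> ^^ Suc k) ` N = \<phi> ` (\<phi> ^^ k) ` N" by (simp add: image_comp)
    then show ?case using Suc \<phi>N by simp
  qed simp
  have \<phi>k: "lin N N (\<phi> ^^ k)" for k by (rule lin_funpow[OF \<phi>])
  let ?K = "\<lambda>k. {x \<in> N. (\<phi> ^^ k) x = 0}"
  have sK: "submod (?K k)" for k by (rule submod_kernel[OF \<phi>k N(1)])
  have "\<exists>A. (\<exists>k. A = ?K k) \<and> (\<forall>B. (\<exists>k. B = ?K k) \<and> A \<subseteq> B \<longrightarrow> B = A)"
    by (rule fdm_maximal[OF fdm_subset[OF fF N(1,2)], where A = "?K 0"], rule exI[of _ 0]) (use sK in auto)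
  then obtain A k where A: "A = ?K k" "\<And>B. \<exists>j. B = ?K j \<Longrightarrow> A \<subseteq> B \<Longrightarrow> B = A" by (elim exE conjE) simp
  have k: "?K j = ?K k" if "?K k \<subseteq> ?K j" for j
    using A(2)[of "?K j"] that unfolding A(1) by (metis (no_types, lifting))
  have le: "?K k \<subseteq> ?K (i + k)" for i
    using lin_zero[OF \<phi>k N(1)] by (auto simp: funpow_add)
  \<comment> \<open>At least \<open>k\<close>, so that \<open>\<phi> ^^ m\<close> is injective on
    \<open>N\<close>; and positive, so that it maps arbitrary vectors into \<open>N\<close>.\<close>
  define m where "m = Suc k"
  have inj0: "x = 0" if x: "x \<in> N" "(\<phi> ^^ m) x = 0" for x
  proof -
    obtain y where y: "y \<in> N" "x = (\<phi> ^^ m) y" using x(1) \<phi>kN[of m] by blast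
    have "(\<phi> ^^ (m + m)) y = 0" using x y by (simp add: funpow_add)
    moreover have "m + m = (m + 1) + k" by (simp add: m_def)
    ultimately have "y \<in> ?K ((m + 1) + k)" using y by simp
    then have "y \<in> ?K k" using k[OF le] by blast
    then show ?thesis using y lin_zero[OF \<phi> N(1)] by (simp add: m_def)
  qed
  have inj: "x = y" if "x \<in> N" "y \<in> N" "(\<phi> ^^ m) x = (\<phi> ^^ m) y" for x y
    using inj0[OF submod_diff[OF N(1) that(1,2)]] lin_diff[OF \<phi>k N(1) that(1,2)] that(3) by simp
  have "\<phi> v \<in> N" for v using lin_mem[OF \<phi>[of UNIV]] by blast
  then have "(\<phi> ^^ m) v \<in> N" for v by (simp add: m_def)
  then have "\<forall>i. \<exists>y. y \<in> N \<and> (\<phi> ^^ m) y = (\<phi> ^^ m) (unit_vec i)" using \<phi>kN[of m] by (metis imageE)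
  \<comment> \<open>The images of the unit vectors, pulled back through the bijection
    \<open>\<phi> ^^ m\<close> of \<open>N\<close>, form the dual basis.\<close>
  then obtain q where q: "\<And>i. q i \<in> N" "\<And>i. (\<phi> ^^ m) (q i) = (\<phi> ^^ m) (unit_vec i)" by metis
  have "lin F F (\<phi> ^^ m)" using lin_funpow[OF lin_mono[OF \<phi>[of F] order_refl N(2)]] .
  then have expand: "(\<phi> ^^ m) x = (\<Sum>i<r. act (x i) ((\<phi> ^^ m) (unit_vec i)))" if "x \<in> N" for x
    using lin_pj[OF pF] that N(2) by blast
  have "x = (\<Sum>i<r. act (x i) (q i))" if x: "x \<in> N" for x
  proof (rule inj[OF x])
    show "(\<Sum>i<r. act (x i) (q i)) \<in> N" using q(1) submod_act[OF N(1)] by (intro submod_sum[OF N(1)]) blast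
    have "(\<phi> ^^ m) (\<Sum>i<r. act (x i) (q i)) = (\<Sum>i<r. (\<phi> ^^ m) (act (x i) (q i)))"
      by (rule lin_sum[OF \<phi>k N(1)]) (use q(1) submod_act[OF N(1)] in blast)
    also have "\<dots> = (\<phi> ^^ m) x" unfolding expand[OF x] using lin_act[OF \<phi>k q(1)] q(2) by simp
    finally show "(\<phi> ^^ m) x = (\<phi> ^^ m) (\<Sum>i<r. act (x i) (q i))" by simp
  qed
  then have pN: "pj {..<r} q N" using N(1) q(1) by (simp add: pj_def)
  have "x \<in> jmult N" if x: "x \<in> N" "p x = 0" for x
  proof (rule pj_jmult[OF pN x(1)])
    fix i assume "i \<in> {..<r}"
    show "x i \<in> J" unfolding jrad_def
    proof (intro InterI, clarify, rule ccontr)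
      fix m :: "'a set" assume m: "maximal_left_ideal m" and xi: "x i \<notin> m"
      have lm: "left_ideal m" using m by (simp add: maximal_left_ideal_def)
      let ?L = "{a * x i | a. a \<in> UNIV}"
      have "left_ideal ?L" unfolding left_ideal_def
        by safe (metis mult_zero_left UNIV_I, metis distrib_right UNIV_I, metis mult.assoc UNIV_I)
      moreover have "\<not> ?L \<subseteq> m" using xi by (metis (mono_tags, lifting) UNIV_I mem_Collect_eq mult_1 subsetD)
      ultimately obtain a where a: "1 - a * x i \<in> m" using maximal_left_ideal_sum[OF m] by blast
      let ?y = "act a x"
      have y: "?y \<in> N" "p ?y = 0" "?y i = a * x i"
        using submod_act[OF N(1) x(1)] lin_act[OF p x(1)] x(2) by (auto simp: act_apply)
      \<comment> \<open>Subtracting a multiple of \<open>?y\<close>, which lies in the kernel of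
        \<open>p\<close>, brings coordinate \<open>i\<close> of any vector into \<open>m\<close>
        without changing its image. So \<open>?N\<close> still maps onto \<open>M\<close>, and
        minimality forces \<open>?N = N\<close>.\<close>
      let ?N = "{v \<in> N. v i \<in> m}"
      have sN: "submod ?N" unfolding submod_def using N(1) lm
        by (auto simp: submod_zero submod_add submod_act zero_fun_apply plus_fun_apply act_apply
            left_ideal_zero left_ideal_add left_ideal_mult)
      have "M \<subseteq> p ` ?N"
      proof
        fix z assume "z \<in> M"
        then obtain v where v: "v \<in> N" "z = p v" using N(3) by blast
        let ?w = "v - act (v i) ?y"
        have "?w \<in> N" using submod_diff[OF N(1) v(1) submod_act[OF N(1) y(1)]] .
        moreover have "?w i = v i * (1 - a * x i)" by (simp add: minus_apply act_apply y(3) algebra_simps)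
        ultimately have "?w \<in> ?N" using left_ideal_mult[OF lm a] by simp
        moreover have "p ?w = z"
          using lin_diff[OF p N(1) v(1) submod_act[OF N(1) y(1)]] lin_act[OF p y(1)] y(2) v(2) by simp
        ultimately show "z \<in> p ` ?N" by blast
      qed
      then have "?N = N" using min[OF sN] lin_mem[OF p] by blast
      then have "?y \<in> ?N" using y(1) by simp
      then have "a * x i \<in> m" using y(3) by simp
      then have "1 \<in> m" using left_ideal_add[OF lm a] by fastforce
      then show False using left_ideal_UNIV[OF lm] m by (auto simp: maximal_left_ideal_def)
    qed
  qed
  then have "cover N M p" unfolding cover_def using pN p N(3) by (auto simp: proj_def)
  then show ?thesis by blast
qed

subsection \<open>Towers of projective covers\<close>

definition cov :: "'a vec set \<Rightarrow> 'a vec set \<times> ('a vec \<Rightarrow> 'a vec)" where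
  "cov M = (SOME C. cover (fst C) M (snd C))"

lemma cover_cov:
  assumes "fdm M" shows "cover (fst (cov M)) M (snd (cov M))"
proof -
  obtain C d where "cover C M d" using ex_cover[OF assms] by blast
  then have "\<exists>C. cover (fst C) M (snd C)" by (intro exI[of _ "(C, d)"]) simp
  then show ?thesis unfolding cov_def by (rule someI_ex)
qed

definition layer :: "bool \<Rightarrow> 'a vec set \<Rightarrow> 'a vec set" where
  "layer l B = (if l then jmult B else soc B)"

primrec tower :: "'a vec set \<Rightarrow> (nat \<Rightarrow> bool) \<Rightarrow> nat \<Rightarrow> 'a vec set" where
  "tower P w 0 = P"
| "tower P w (Suc i) = fst (cov (layer (w i) (tower P w i)))"

definition tdiff :: "'a vec set \<Rightarrow> (nat \<Rightarrow> bool) \<Rightarrow> nat \<Rightarrow> 'a vec \<Rightarrow> 'a vec" where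
  "tdiff P w i = snd (cov (layer (w i) (tower P w i)))"

lemma fdm_layer: "proj3 B \<Longrightarrow> fdm (layer l B)"
  using fdm_subset[OF fdm_proj] proj_submod[of B] jmult_subset[of B] soc_subset[of B]
  by (auto simp: layer_def proj3_def)

lemma proj3_cov_layer:
  assumes "proj3 B" shows "proj3 (fst (cov (layer l B)))"
proof (cases l)
  case True
  then show ?thesis
    using proj3_jmult_cover[OF assms] cover_cov[OF fdm_layer[OF assms, of l]] by (simp add: layer_def)
next
  case False
  then show ?thesis
    using proj3_soc_cover[OF assms] cover_cov[OF fdm_layer[OF assms, of l]] by (simp add: layer_def)
qed

lemma proj3_tower: "proj3 P \<Longrightarrow> proj3 (tower P w i)"
  by (induction i) (auto simp: proj3_cov_layer)

lemma cover_tower: "proj3 P \<Longrightarrow> cover (tower P w (Suc i)) (layer (w i) (tower P w i)) (tdiff P w i)"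
  using cover_cov[OF fdm_layer[OF proj3_tower]] by (simp add: tdiff_def)

lemma proj3_submod: "proj3 B \<Longrightarrow> submod B" by (auto simp: proj3_def proj_submod)

lemma layer_jmult: "proj3 B \<Longrightarrow> layer l B \<subseteq> jmult B"
  using proj3_soc[of B] jmult_subset[OF submod_jmult[of B]] by (auto simp: layer_def)

lemma tdiff_mem: "proj3 P \<Longrightarrow> x \<in> tower P w (Suc i) \<Longrightarrow> tdiff P w i x \<in> jmult (tower P w i)"
  using lin_mem[OF coverD(2)[OF cover_tower]] layer_jmult[OF proj3_tower] by blast

lemma lin_tdiff: "proj3 P \<Longrightarrow> lin (tower P w (Suc i)) (tower P w i) (tdiff P w i)"
  using lin_mono[OF coverD(2)[OF cover_tower] order_refl
      order_trans[OF layer_jmult[OF proj3_tower] jmult_subset[OF proj3_submod[OF proj3_tower]]]] .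

text \<open>After a socle step at level \<open>i\<close>, the next differential lands in the
  radical, which becomes \<open>J\<close> times a socle. After a radical step the next one lands in
  the socle, which the radical differential below kills.\<close>

lemma tdiff_tdiff:
  assumes P: "proj3 P" and w: "\<not> (w i \<and> w (Suc i))" and x: "x \<in> tower P w (Suc (Suc i))"
  shows "tdiff P w i (tdiff P w (Suc i) x) = 0"
proof (cases "w i")
  case True
  then have "tdiff P w (Suc i) x \<in> soc (tower P w (Suc i))"
    using w lin_mem[OF coverD(2)[OF cover_tower[OF P]] x] by (simp add: layer_def)
  then show ?thesis
    by (intro radical_kills_soc[OF _ _ lin_tdiff[OF P] tdiff_mem[OF P]])
      (use proj3_tower[OF P] in \<open>simp_all add: proj3_def del: tower.simps\<close>)
next
  case False
  have "tdiff P w (Suc i) x \<in> jmult (tower P w (Suc i))" by (rule tdiff_mem[OF P x])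
  then have "tdiff P w i (tdiff P w (Suc i) x) \<in> jmult (soc (tower P w i))"
    using False lin_mem[OF coverD(2)[OF cover_tower[OF P, of w i]]]
    by (intro lin_jmult[OF coverD(2)[OF cover_tower[OF P, of w i]] proj3_submod[OF proj3_tower[OF P]]])
      (simp_all add: layer_def del: tower.simps)
  then show ?thesis by (simp add: jmult_soc)
qed

section \<open>A local projective at the bottom\<close>

lemma ex_simple_submod:
  assumes "fdm A" "A \<noteq> {0}"
  shows "\<exists>S. submod S \<and> S \<subseteq> A \<and> S \<noteq> {0} \<and> (\<forall>B. submod B \<and> B \<subseteq> S \<and> B \<noteq> {0} \<longrightarrow> B = S)"
proof -
  have "\<exists>S. (submod S \<and> S \<subseteq> A \<and> S \<noteq> {0}) \<and>
      (\<forall>B. (submod B \<and> B \<subseteq> A \<and> B \<noteq> {0}) \<and> B \<subseteq> S \<longrightarrow> B = S)"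
    by (rule fdm_minimal[OF assms(1), of "\<lambda>S. submod S \<and> S \<subseteq> A \<and> S \<noteq> {0}" A])
      (use assms fdm_submod in auto)
  then show ?thesis by (metis order_trans)
qed

text \<open>Locality for endomorphisms that are idempotent only modulo the radical: a summand in the
  homotopy category yields no better idempotent on \<open>P\<close>, because homotopies contribute
  terms in \<open>J P\<close>.\<close>

definition local_mod :: "'a vec set \<Rightarrow> bool" where
  "local_mod P \<longleftrightarrow> (\<forall>g. lin P P g \<and> (\<forall>x\<in>P. g (g x) - g x \<in> jmult P) \<longrightarrow>
     (\<forall>x\<in>P. g x \<in> jmult P) \<or> (\<forall>x\<in>P. x - g x \<in> jmult P))"

text \<open>If \<open>g\<close> is not radical, then \<open>d\<close> after \<open>g\<close> is
  nonzero, hence onto the simple \<open>S\<close>. So every \<open>p\<close> is some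
  \<open>g u\<close> up to \<open>J P\<close>, and there \<open>g\<close> is the identity modulo
  \<open>J P\<close>.\<close>

lemma local_mod_cover_simple:
  assumes S: "submod S" "jmult S = {0}" "\<And>B. submod B \<Longrightarrow> B \<subseteq> S \<Longrightarrow> B \<noteq> {0} \<Longrightarrow> B = S"
    and c: "cover P S d"
  shows "local_mod P"
  unfolding local_mod_def
proof (intro allI impI, elim conjE)
  fix g assume g: "lin P P g" and idem: "\<forall>x\<in>P. g (g x) - g x \<in> jmult P"
  have sP: "submod P" using coverD(1)[OF c] proj_submod by blast
  have d: "lin P S d" using coverD(2)[OF c] .
  show "(\<forall>x\<in>P. g x \<in> jmult P) \<or> (\<forall>x\<in>P. x - g x \<in> jmult P)"
  proof (cases "\<forall>x\<in>P. g x \<in> jmult P")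
    case False
    then obtain q where q: "q \<in> P" "g q \<notin> jmult P" by blast
    have dg: "lin P S (\<lambda>x. d (g x))" using lin_comp[OF g d] .
    have "d (g q) \<noteq> 0" using coverD(4)[OF c lin_mem[OF g q(1)]] q(2) by blast
    then have "(\<lambda>x. d (g x)) ` P \<noteq> {0}" using q(1) by blast
    then have im: "(\<lambda>x. d (g x)) ` P = S"
      using S(3)[OF submod_image[OF dg sP]] lin_mem[OF dg] by blast
    have "p - g p \<in> jmult P" if p: "p \<in> P" for p
    proof -
      have "d p \<in> (\<lambda>x. d (g x)) ` P" using im lin_mem[OF d p] by simp
      then obtain u where u: "u \<in> P" "d p = d (g u)" by blast
      have gu: "g u \<in> P" using lin_mem[OF g u(1)] .
      let ?j = "p - g u"
      have jP: "?j \<in> P" using submod_diff[OF sP p gu] .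
      have j: "?j \<in> jmult P"
        using coverD(4)[OF c jP] lin_diff[OF d sP p gu] u(2) by simp
      have gj: "g ?j \<in> jmult P" by (rule lin_jmult[OF g sP lin_mem[OF g] j])
      have "g p = g (g u) + g ?j" using lin_diff[OF g sP p gu] by simp
      then have "p - g p = ?j - (g (g u) - g u) - g ?j" by (simp add: algebra_simps)
      then show ?thesis
        using submod_diff[OF submod_jmult submod_diff[OF submod_jmult j] gj] idem u(1) by metis
    qed
    then show ?thesis by blast
  qed blast
qed

lemma ex_proj3_local:
  assumes "a \<in> J" "b \<in> J" "a * b \<noteq> 0"
  shows "\<exists>P. proj3 P \<and> P \<noteq> {0} \<and> local_mod P"
proof -
  let ?F = "free 1 :: 'a vec set"
  let ?A = "jmult (jmult ?F)"
  have fF: "fdm ?F" using fdm_proj pj_free proj_def by blast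
  have fA: "fdm ?A"
    using fdm_subset[OF fF submod_jmult] jmult_subset[OF submod_jmult[of ?F]] jmult_subset[of ?F] by simp
  let ?e = "unit_vec 0 :: 'a vec"
  have e: "?e \<in> ?F" by (auto simp: free_def unit_vec_def)
  have "act a (act b ?e) \<in> ?A" using act_in_jmult[OF assms(1) act_in_jmult[OF assms(2) e]] .
  moreover have "act a (act b ?e) 0 \<noteq> 0" using assms(3) by (simp add: act_apply unit_vec_def)
  ultimately have "?A \<noteq> {0}" by (metis singletonD zero_fun_apply)
  then obtain S where S: "submod S" "S \<subseteq> ?A" "S \<noteq> {0}"
    "\<And>B. submod B \<Longrightarrow> B \<subseteq> S \<Longrightarrow> B \<noteq> {0} \<Longrightarrow> B = S" using ex_simple_submod[OF fA] by metis
  have fS: "fdm S" using fdm_subset[OF fA S(1,2)] .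
  have JS: "jmult S = {0}" using S(4)[OF submod_jmult jmult_subset[OF S(1)]] nakayama[OF fS S(3)] by blast
  obtain P d where c: "cover P S d" using ex_cover[OF fS] by blast
  have "proj3 P"
  \<comment> \<open>\<open>soc2_ring\<close> annihilates all of \<open>J^2\<close>, so it acts as
    zero on \<open>S\<close>.\<close>
  proof (rule proj3_cover[OF c])
    fix t m assume "t \<in> soc2_ring" "m \<in> S"
    then have "act t m = 0" using soc2_ring_jmult2 S(2) by blast
    then show "act t m \<in> jmult S" by (simp add: jmult.zero)
  qed
  moreover have "P \<noteq> {0}"
  proof
    assume "P = {0}"
    then have "S = {0}" using coverD(3)[OF c] lin_zero[OF coverD(2)[OF c]] by auto
    then show False using S(3) by blast
  qed
  moreover have "local_mod P" using local_mod_cover_simple[OF S(1) JS S(4) c] .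
  ultimately show ?thesis by blast
qed

lemma tower_nonzero:
  assumes P: "proj3 P" "P \<noteq> {0}" shows "tower P w i \<noteq> {0}"
proof (induction i)
  case (Suc i)
  let ?B = "tower P w i"
  have B: "proj3 ?B" using proj3_tower[OF P(1)] .
  obtain x where x: "x \<in> soc ?B" "x \<noteq> 0"
    using soc_nonzero[OF fdm_proj Suc] B by (auto simp: proj3_def)
  then have xl: "x \<in> layer (w i) ?B"
    using proj3_soc[OF B] jmult_subset[OF submod_jmult[of ?B]] by (auto simp: layer_def)
  have c: "cover (tower P w (Suc i)) (layer (w i) ?B) (tdiff P w i)" using cover_tower[OF P(1)] .
  show ?case
  proof
    assume "tower P w (Suc i) = {0}"
    then have "layer (w i) ?B = {0}"
      using coverD(3)[OF c] lin_zero[OF coverD(2)[OF c]] by auto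
    then show False using xl x(2) by blast
  qed
qed (simp add: P)

text \<open>Reading upwards from level \<open>5j + 1\<close>, the word \<open>word j\<close> continues with radical, socle,
  socle, socle, whereas each \<open>word k\<close> with \<open>k > j\<close> continues with socle, radical, socle, radical.
  A chain map that is not radical below this place is incompatible with either direction.\<close>

definition word :: "nat \<Rightarrow> nat \<Rightarrow> bool" where
  "word j i \<longleftrightarrow> (i < 5 * j \<and> (i mod 5 = 2 \<or> i mod 5 = 4)) \<or> i = 5 * j + 1"

lemma word_0 [simp]: "\<not> word j 0" by (auto simp: word_def)

lemma word_no_consecutive: "\<not> (word j i \<and> word j (Suc i))"
proof
  assume a: "word j i \<and> word j (Suc i)"
  have "Suc i mod 5 = (if i mod 5 = 4 then 0 else Suc (i mod 5))" by (simp add: mod_Suc)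
  then show False using a unfolding word_def by (auto split: if_splits)
qed

lemma word_cong: "i < 5 * j + 1 \<Longrightarrow> j < k \<Longrightarrow> word j i = word k i"
  by (cases "i = 5 * j") (auto simp: word_def)

lemma word_short:
  "word j (5 * j + 1)" "\<not> word j (5 * j + 2)" "\<not> word j (5 * j + 3)" "\<not> word j (5 * j + 4)"
  by (auto simp: word_def)

lemma word_long:
  assumes "j < k"
  shows "\<not> word k (5 * j + 1)" "word k (5 * j + 2)" "\<not> word k (5 * j + 3)" "word k (5 * j + 4)"
proof -
  have m: "(5 * j + 1) mod 5 = 1" "(5 * j + 2) mod 5 = 2" "(5 * j + 3) mod 5 = 3" "(5 * j + 4) mod 5 = 4"
    by presburger+
  show "\<not> word k (5 * j + 1)" "word k (5 * j + 2)" "\<not> word k (5 * j + 3)" "word k (5 * j + 4)"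
    using assms m unfolding word_def by auto
qed

text \<open>Level 0 is left out because the towers are glued there, and only the levels above split
  into components. Below the first difference \<open>p\<close> of the words radicality descends
  through equal letters; the two directions differ in how it is reached at \<open>p\<close>.\<close>

lemma tower_map_radical:
  assumes P: "proj3 P" and jk: "j \<noteq> k" "j < n" "k < n"
    and F: "\<And>i. 1 \<le> i \<Longrightarrow> i \<le> 5 * n \<Longrightarrow> lin (tower P (word j) i) (tower P (word k) i) (F i)"
    and comm: "\<And>i x. 1 \<le> i \<Longrightarrow> i < 5 * n \<Longrightarrow> x \<in> tower P (word j) (Suc i) \<Longrightarrow>
      F i (tdiff P (word j) i x) = tdiff P (word k) i (F (Suc i) x)"
    and x: "x \<in> tower P (word j) 1"
  shows "F 1 x \<in> jmult (tower P (word k) 1)"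
proof -
  define R where "R i \<longleftrightarrow> (\<forall>x\<in>tower P (word j) i. F i x \<in> jmult (tower P (word k) i))" for i
  have B: "proj3 (tower P (word l) i)" for l i by (rule proj3_tower[OF P])
  have c: "cover (tower P (word l) (Suc i)) (layer (word l i) (tower P (word l) i)) (tdiff P (word l) i)" for l i
    by (rule cover_tower[OF P])
  have down: "R i" if i: "1 \<le> i" "i < 5 * n" and eq: "word j i = word k i" and R: "R (Suc i)" for i
    unfolding R_def
  proof
    fix b assume b: "b \<in> tower P (word j) i"
    have f: "lin (tower P (word j) i) (tower P (word k) i) (F i)"
      "lin (tower P (word j) (Suc i)) (tower P (word k) (Suc i)) (F (Suc i))" using F i by (auto simp del: tower.simps)
    show "F i b \<in> jmult (tower P (word k) i)"
    proof (cases "word j i")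
      case True
      with eq have "word k i" by simp
      show ?thesis
        by (rule radical_step_jmult[where d = "tdiff P (word j) i" and d' = "tdiff P (word k) i" and ?f0.0 = "F i" and ?f1.0 = "F (Suc i)",
          OF B B _ _ f comm[OF i] _ b])
          (use c[of j i] c[of k i] True \<open>word k i\<close> R in \<open>simp_all add: layer_def R_def del: tower.simps\<close>)
    next
      case False
      with eq have "\<not> word k i" by simp
      show ?thesis
        by (rule radical_step_soc[where d = "tdiff P (word j) i" and d' = "tdiff P (word k) i" and ?f0.0 = "F i" and ?f1.0 = "F (Suc i)",
          OF B B _ _ f comm[OF i] _ b])
          (use c[of j i] c[of k i] False \<open>\<not> word k i\<close> R in \<open>simp_all add: layer_def R_def del: tower.simps\<close>)
    qed
  qed
  have block: "R i" if i: "1 \<le> i" "i < 5 * n" and w: "word j i" "\<not> word k i" for i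
    unfolding R_def
  proof
    fix b assume b: "b \<in> tower P (word j) i"
    have f: "lin (tower P (word j) i) (tower P (word k) i) (F i)"
      "lin (tower P (word j) (Suc i)) (tower P (word k) (Suc i)) (F (Suc i))" using F i by (auto simp del: tower.simps)
    show "F i b \<in> jmult (tower P (word k) i)"
      by (rule radical_jmult_soc[where d = "tdiff P (word j) i" and d' = "tdiff P (word k) i" and ?f0.0 = "F i" and ?f1.0 = "F (Suc i)",
          OF B B _ _ f comm[OF i] b])
        (use c[of j i] c[of k i] w in \<open>simp_all add: layer_def del: tower.simps\<close>)
  qed
  have exchange: "R i" if i: "1 \<le> i" "Suc i < 5 * n"
    and w: "\<not> word j i" "word j (Suc i)" "word k i" "\<not> word k (Suc i)" and R: "R (Suc (Suc i))" for i
    unfolding R_def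
  proof
    fix b assume b: "b \<in> tower P (word j) i"
    have f: "lin (tower P (word j) i) (tower P (word k) i) (F i)"
      "lin (tower P (word j) (Suc i)) (tower P (word k) (Suc i)) (F (Suc i))"
      "lin (tower P (word j) (Suc (Suc i))) (tower P (word k) (Suc (Suc i))) (F (Suc (Suc i)))"
      using F i by (auto simp del: tower.simps)
    show "F i b \<in> jmult (tower P (word k) i)"
      by (rule radical_step_exchange[where d = "tdiff P (word j) i" and d' = "tdiff P (word k) i" and ?f0.0 = "F i" and ?f1.0 = "F (Suc i)"
          and e = "tdiff P (word j) (Suc i)" and e' = "tdiff P (word k) (Suc i)" and ?f2.0 = "F (Suc (Suc i))",
          OF B B _ _ _ _ f comm[OF i(1) Suc_lessD[OF i(2)]] comm[OF le_SucI[OF i(1)] i(2)] _ b])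
        (use c[of j i] c[of k i] c[of j "Suc i"] c[of k "Suc i"] w i R
          in \<open>simp_all add: layer_def R_def del: tower.simps\<close>)
  qed
  define p where "p = 5 * min j k + 1"
  have "R p"
  proof (cases "j < k")
    case True
    then show ?thesis using block[of p] word_short(1)[of j] word_long(1)[OF True] jk by (simp add: p_def)
  next
    case False
    with jk have kj: "k < j" by simp
    have ps: "p = 5 * k + 1" "Suc p = 5 * k + 2" "Suc (Suc p) = 5 * k + 3" "Suc (Suc (Suc p)) = 5 * k + 4"
      using kj by (auto simp: p_def)
    note w = word_short[of k, folded ps] word_long[OF kj, folded ps]
    \<comment> \<open>From \<open>p\<close> upwards the source reads socle, radical, socle, radical
      and the target radical, socle, socle, socle: the fourth pair creates radicality, the third
      passes it down, the first two form an exchange.\<close>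
    have "R (Suc (Suc (Suc p)))" using block w jk kj ps by simp
    then have "R (Suc (Suc p))" using down[of "Suc (Suc p)"] w jk kj ps by simp
    then show ?thesis using exchange[of p] w jk kj ps by simp
  qed
  have eq: "word j i = word k i" if "i < p" for i
    using word_cong[of i j k] word_cong[of i k j] that jk unfolding p_def by (cases "j < k") auto
  have "p \<le> 5 * n" using jk by (auto simp: p_def)
  have "R i" if "1 \<le> i" "i \<le> p" for i
    using that(2,1)
  proof (induction rule: inc_induct)
    case (step i)
    then show ?case using down[of i] eq[of i] \<open>p \<le> 5 * n\<close> by simp
  qed (rule \<open>R p\<close>)
  from this[of 1] have "R 1" by (simp add: p_def)
  then show ?thesis using x unfolding R_def by blast
qed

end

section \<open>Direct sums and contractibility\<close>

text \<open>\<open>emb j\<close> uses row \<open>j\<close> of \<open>nat\<close> viewed as pairs,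
  which keeps direct sums inside the type \<open>'a vec\<close>.\<close>

definition emb :: "nat \<Rightarrow> 'a::ring_1 vec \<Rightarrow> 'a vec" where
  "emb j b = (\<lambda>s. if fst (prod_decode s) = j then b (snd (prod_decode s)) else 0)"

definition coord :: "nat \<Rightarrow> 'a::ring_1 vec \<Rightarrow> 'a vec" where
  "coord j v = (\<lambda>t. v (prod_encode (j, t)))"

definition dsum :: "nat \<Rightarrow> (nat \<Rightarrow> 'a::ring_1 vec set) \<Rightarrow> 'a vec set" where
  "dsum n B = {v. (\<forall>j<n. coord j v \<in> B j) \<and> (\<forall>j\<ge>n. coord j v = 0)}"

lemma coord_zero [simp]: "coord j 0 = 0" by (auto simp: coord_def fun_eq_iff vec_apply)
lemma coord_add: "coord j (x + y) = coord j x + coord j y" by (auto simp: coord_def fun_eq_iff vec_apply)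
lemma coord_act: "coord j (act a x) = act a (coord j x)" by (auto simp: coord_def fun_eq_iff act_apply)
lemma coord_sum: "coord j (\<Sum>i\<in>A. f i) = (\<Sum>i\<in>A. coord j (f i))"
  by (auto simp: coord_def fun_eq_iff sum_fun_apply)
lemma emb_zero [simp]: "emb j 0 = 0" by (auto simp: emb_def fun_eq_iff vec_apply)
lemma emb_add: "emb j (x + y) = emb j x + emb j y" by (auto simp: emb_def fun_eq_iff vec_apply)
lemma emb_act: "emb j (act a x) = act a (emb j x)" by (auto simp: emb_def fun_eq_iff act_apply)
lemma coord_emb: "coord i (emb j b) = (if i = j then b else 0)"
  by (auto simp: coord_def emb_def fun_eq_iff vec_apply)

lemma vec_eq_coord: "(\<And>j. coord j v = coord j v') \<Longrightarrow> v = v'"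
proof
  fix s assume "\<And>j. coord j v = coord j v'"
  then have "coord (fst (prod_decode s)) v (snd (prod_decode s)) = coord (fst (prod_decode s)) v' (snd (prod_decode s))"
    by simp
  then show "v s = v' s" by (simp add: coord_def)
qed

lemma coord_sum_emb: "coord i (\<Sum>j<n. emb j (g j)) = (if i < n then g i else 0)"
proof -
  have "coord i (\<Sum>j<n. emb j (g j)) = (\<Sum>j<n. if i = j then g j else 0)"
    unfolding coord_sum coord_emb by (intro sum.cong) auto
  then show ?thesis by simp
qed

lemma submod_dsum: "(\<And>j. j < n \<Longrightarrow> submod (B j)) \<Longrightarrow> submod (dsum n B)"
  unfolding submod_def[of "dsum n B"]
  by (auto simp: dsum_def coord_add coord_act submod_zero submod_add submod_act)

lemma lin_coord: "j < n \<Longrightarrow> lin (dsum n B) (B j) (coord j)"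
  by (auto simp: lin_def dsum_def coord_add coord_act)

lemma emb_mem: "j < n \<Longrightarrow> (\<And>j. j < n \<Longrightarrow> submod (B j)) \<Longrightarrow> b \<in> B j \<Longrightarrow> emb j b \<in> dsum n B"
  by (auto simp: dsum_def coord_emb submod_zero)

lemma lin_emb: "j < n \<Longrightarrow> (\<And>j. j < n \<Longrightarrow> submod (B j)) \<Longrightarrow> lin (B j) (dsum n B) (emb j)"
  using emb_mem[of j n B] by (auto simp: lin_def emb_add emb_act)

lemma dsum_expand: "v \<in> dsum n B \<Longrightarrow> v = (\<Sum>j<n. emb j (coord j v))"
  by (rule vec_eq_coord) (auto simp: coord_sum_emb dsum_def)

lemma dsum_jmult:
  assumes "\<And>j. j < n \<Longrightarrow> submod (B j)" "v \<in> dsum n B" "\<And>j. j < n \<Longrightarrow> coord j v \<in> jmult (B j)"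
  shows "v \<in> jmult (dsum n B)"
proof -
  have "emb j (coord j v) \<in> jmult (dsum n B)" if j: "j < n" for j
    by (rule lin_jmult[OF lin_emb[of j n B, OF j assms(1)] assms(1)[OF j] emb_mem[of j n B, OF j assms(1)] assms(3)[OF j]])
  then have "(\<Sum>j<n. emb j (coord j v)) \<in> jmult (dsum n B)"
    by (intro submod_sum[OF submod_jmult]) auto
  then show ?thesis using dsum_expand[OF assms(2)] by simp
qed

lemma proj_dsum:
  assumes "\<And>j. j < n \<Longrightarrow> proj (B j)"
  shows "proj (dsum n B)"
proof -
  have "\<forall>j. \<exists>I q. j < n \<longrightarrow> pj I q (B j)" using assms by (auto simp: proj_def)
  then obtain I q where pj: "\<And>j. j < n \<Longrightarrow> pj (I j) (q j) (B j)" by metis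
  have sB: "submod (B j)" if "j < n" for j using assms[OF that] proj_submod by blast
  define K where "K = prod_encode ` (SIGMA j:{..<n}. I j)"
  define Q where "Q s = emb (fst (prod_decode s)) (q (fst (prod_decode s)) (snd (prod_decode s)))" for s
  have fI: "finite (I j)" if "j < n" for j using pj[OF that] by (simp add: pj_def)
  have "finite K" unfolding K_def using fI by (intro finite_imageI finite_SigmaI) auto
  moreover have "Q s \<in> dsum n B" if "s \<in> K" for s
    using that pj_mem[OF pj] unfolding K_def Q_def by (auto intro!: emb_mem sB)
  moreover have "v = (\<Sum>s\<in>K. act (v s) (Q s))" if v: "v \<in> dsum n B" for v
  proof -
    have cv: "coord j v \<in> B j" if "j < n" for j using v that by (simp add: dsum_def)
    have "emb j (coord j v) = (\<Sum>i\<in>I j. act (v (prod_encode (j, i))) (Q (prod_encode (j, i))))" if j: "j < n" for j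
    proof -
      have "emb j (coord j v) = emb j (\<Sum>i\<in>I j. act (coord j v i) (q j i))"
        using pj_expand[OF pj[OF j] cv[OF j]] by simp
      also have "\<dots> = (\<Sum>i\<in>I j. emb j (act (coord j v i) (q j i)))"
        by (rule lin_sum[OF lin_emb[of j n B, OF j sB] sB[OF j]])
          (auto intro!: submod_act[OF sB[OF j]] pj_mem[OF pj[OF j]])
      finally show ?thesis by (simp add: emb_act Q_def coord_def)
    qed
    then have "v = (\<Sum>j<n. \<Sum>i\<in>I j. act (v (prod_encode (j, i))) (Q (prod_encode (j, i))))"
      using dsum_expand[OF v] by simp
    also have "\<dots> = (\<Sum>(j, i)\<in>(SIGMA j:{..<n}. I j). act (v (prod_encode (j, i))) (Q (prod_encode (j, i))))"
      using fI by (intro sum.Sigma) auto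
    also have "\<dots> = (\<Sum>s\<in>K. act (v s) (Q s))"
      unfolding K_def by (subst sum.reindex) (auto simp: inj_on_def case_prod_beta)
    finally show ?thesis .
  qed
  ultimately have "pj K Q (dsum n B)" using submod_dsum[OF sB] by (simp add: pj_def)
  then show ?thesis by (auto simp: proj_def)
qed

lemma proj_zero: "proj {0}"
  unfolding proj_def pj_def by (intro exI[of _ "{}"]) simp

lemma funpow_mem: "lin A A f \<Longrightarrow> x \<in> A \<Longrightarrow> (f ^^ k) x \<in> A"
  using lin_mem[OF lin_funpow] .

text \<open>The map \<open>p \<circ> i\<close> is homotopic to the identity, and its powers factor through those of
  \<open>i \<circ> p\<close>.\<close>

lemma contractible_if_nilpotent:
  assumes X: "\<And>n. submod (fst X n)" and Y: "\<And>n. submod (fst Y n)"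
    and dY: "\<And>n. lin (fst Y n) (fst Y (n - 1)) (snd Y n)"
    and i: "chain_map Y X i" and p: "chain_map X Y p" and id: "homotopic Y Y (ccomp p i) cid"
    and nil: "\<And>n x. x \<in> fst X n \<Longrightarrow> ((\<lambda>x. i n (p n x)) ^^ k) x = 0"
  shows "contractible Y"
proof -
  define u where "u n x = p n (i n x)" for n x
  have i': "\<And>n. lin (fst Y n) (fst X n) (i n)" "\<And>n x. x \<in> fst Y n \<Longrightarrow> snd X n (i n x) = i (n - 1) (snd Y n x)"
    and p': "\<And>n. lin (fst X n) (fst Y n) (p n)" "\<And>n x. x \<in> fst X n \<Longrightarrow> snd Y n (p n x) = p (n - 1) (snd X n x)"
    using i p by (auto simp: chain_map_def)
  have u: "lin (fst Y n) (fst Y n) (u n)" for n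
    using lin_comp[OF i'(1) p'(1)] unfolding u_def .
  have ud: "snd Y n (u n x) = u (n - 1) (snd Y n x)" if "x \<in> fst Y n" for n x
    using p'(2)[OF lin_mem[OF i'(1) that]] i'(2)[OF that] by (simp add: u_def)
  obtain h1 where h1: "\<And>n. lin (fst Y n) (fst Y (n + 1)) (h1 n)"
    "\<And>n x. x \<in> fst Y n \<Longrightarrow> u n x - x = snd Y (n + 1) (h1 n x) + h1 (n - 1) (snd Y n x)"
    using id unfolding homotopic_def ccomp_def cid_def u_def by blast
  have "\<exists>h. (\<forall>n. lin (fst Y n) (fst Y (n + 1)) (h n)) \<and>
      (\<forall>n. \<forall>x\<in>fst Y n. (u n ^^ m) x - x = snd Y (n + 1) (h n x) + h (n - 1) (snd Y n x))" for m
  proof (induction m)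
    case 0
    show ?case
      by (intro exI[of _ "\<lambda>n x. 0"]) (use lin_zero[OF dY Y] in \<open>auto intro!: lin_const_zero Y\<close>)
  next
    case (Suc m)
    then obtain h where h: "\<And>n. lin (fst Y n) (fst Y (n + 1)) (h n)"
      "\<And>n x. x \<in> fst Y n \<Longrightarrow> (u n ^^ m) x - x = snd Y (n + 1) (h n x) + h (n - 1) (snd Y n x)" by blast
    \<comment> \<open>The homotopy belonging to
      \<open>u^(m+1) - 1 = u (u^m - 1) + (u - 1)\<close>.\<close>
    let ?h = "\<lambda>n x. u (n + 1) (h n x) + h1 n x"
    have "lin (fst Y n) (fst Y (n + 1)) (?h n)" for n
      by (intro lin_plus h1 Y lin_comp[OF h(1) u])
    moreover have "(u n ^^ Suc m) x - x = snd Y (n + 1) (?h n x) + ?h (n - 1) (snd Y n x)"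
      if x: "x \<in> fst Y n" for n x
    proof -
      have dx: "snd Y n x \<in> fst Y (n - 1)" using lin_mem[OF dY x] .
      have hx: "h n x \<in> fst Y (n + 1)" "h1 n x \<in> fst Y (n + 1)" using lin_mem[OF h(1) x] lin_mem[OF h1(1) x] by auto
      have hd: "h (n - 1) (snd Y n x) \<in> fst Y n" using lin_mem[OF h(1) dx] by simp
      have dh: "snd Y (n + 1) (h n x) \<in> fst Y n" using lin_mem[OF dY hx(1)] by simp
      have um: "(u n ^^ m) x \<in> fst Y n" using funpow_mem[OF u x] .
      have "(u n ^^ Suc m) x - x = u n ((u n ^^ m) x - x) + (u n x - x)"
        using lin_diff[OF u Y um x] by simp
      also have "u n ((u n ^^ m) x - x) = u n (snd Y (n + 1) (h n x)) + u n (h (n - 1) (snd Y n x))"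
        unfolding h(2)[OF x] using lin_add[OF u dh hd] .
      also have "u n (snd Y (n + 1) (h n x)) = snd Y (n + 1) (u (n + 1) (h n x))"
        using ud[OF hx(1)] by simp
      also have "u n x - x = snd Y (n + 1) (h1 n x) + h1 (n - 1) (snd Y n x)" using h1(2)[OF x] .
      also have "snd Y (n + 1) (u (n + 1) (h n x)) + u n (h (n - 1) (snd Y n x)) +
          (snd Y (n + 1) (h1 n x) + h1 (n - 1) (snd Y n x)) =
          (snd Y (n + 1) (u (n + 1) (h n x)) + snd Y (n + 1) (h1 n x)) + ?h (n - 1) (snd Y n x)"
        by (simp add: algebra_simps)
      also have "snd Y (n + 1) (u (n + 1) (h n x)) + snd Y (n + 1) (h1 n x) = snd Y (n + 1) (?h n x)"
        using lin_add[OF dY lin_mem[OF u hx(1)] hx(2)] by simp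
      finally show ?thesis .
    qed
    ultimately show ?case by (intro exI[of _ ?h]) blast
  qed
  then obtain h where h: "\<And>n. lin (fst Y n) (fst Y (n + 1)) (h n)"
    "\<And>n x. x \<in> fst Y n \<Longrightarrow> (u n ^^ Suc k) x - x = snd Y (n + 1) (h n x) + h (n - 1) (snd Y n x)" by metis
  have fac: "(u n ^^ Suc m) x = p n (((\<lambda>x. i n (p n x)) ^^ m) (i n x))" for n m x
    by (induction m) (simp_all add: u_def)
  have "(u n ^^ Suc k) x = 0" if x: "x \<in> fst Y n" for n x
    unfolding fac using nil[OF lin_mem[OF i'(1) x]] lin_zero[OF p'(1) X] by simp
  then have "x = - snd Y (n + 1) (h n x) + - h (n - 1) (snd Y n x)" if x: "x \<in> fst Y n" for n x
    using h(2)[OF x] x by (metis add.inverse_inverse add_uminus_conv_diff diff_0 minus_add_distrib)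
  moreover have "- snd Y (n + 1) (h n x) = snd Y (n + 1) (- h n x)" if x: "x \<in> fst Y n" for n x
    using lin_minus[OF dY lin_mem[OF h(1) x]] by simp
  ultimately have "\<forall>n. \<forall>x\<in>fst Y n. x - 0 = snd Y (n + 1) (- h n x) + - h (n - 1) (snd Y n x)" by simp
  moreover have "lin (fst Y n) (fst Y (n + 1)) (\<lambda>x. - h n x)" for n by (intro lin_uminus h Y)
  ultimately show ?thesis
    unfolding contractible_def homotopic_def cid_def czero_def by (intro exI[of _ "\<lambda>n x. - h n x"]) blast
qed

lemma lin_sum_fun:
  "submod N \<Longrightarrow> (\<And>j. j \<in> A \<Longrightarrow> lin M N (f j)) \<Longrightarrow> lin M N (\<lambda>x. \<Sum>j\<in>A. f j x)"
  unfolding lin_def by (auto intro!: submod_sum simp: sum.distrib act_sum)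

lemma funpow_zero_mono:
  assumes h: "lin B B h" "submod B" "(h ^^ k) x = 0" "k \<le> k'"
  shows "(h ^^ k') x = 0"
proof -
  have "(h ^^ m) 0 = 0" for m by (induction m) (simp_all add: lin_zero[OF h(1,2)])
  moreover have "(h ^^ k') x = (h ^^ (k' - k)) ((h ^^ k) x)"
    using h(4) funpow_add[of "k' - k" k h] by simp
  ultimately show ?thesis using h(3) by simp
qed

context self_inj_algebra
begin

declare tower.simps(2) [simp del]

lemma radical_nilpotent:
  fixes B :: "'a vec set"
  assumes B: "fdm B" and h: "lin B B h" and rad: "\<And>x. x \<in> B \<Longrightarrow> h x \<in> jmult B"
  shows "\<exists>k. \<forall>x\<in>B. (h ^^ k) x = 0"
proof -
  obtain k where k: "(jmult ^^ k) B = {0}" using ex_jmult_funpow_zero[OF B] by blast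
  have "(h ^^ i) x \<in> (jmult ^^ i) B" if "x \<in> B" for i x
  proof (induction i)
    case (Suc i)
    then show ?case using jmult_funpow_shift[OF fdm_submod[OF B] h, of 0 _ i] rad by simp
  qed (use that in simp)
  then show ?thesis using k by blast
qed

lemma tdiff_0_jmult:
  assumes "proj3 P" "\<not> w 0" "x \<in> jmult (tower P w 1)"
  shows "tdiff P w 0 x = 0"
proof -
  have c: "cover (tower P w 1) (soc P) (tdiff P w 0)"
    using cover_tower[OF assms(1), of w 0] assms(2) by (simp add: layer_def)
  have "tdiff P w 0 x \<in> jmult (soc P)"
    by (rule lin_jmult[OF coverD(2)[OF c] proj3_submod[OF proj3_tower[OF assms(1)]] lin_mem[OF coverD(2)[OF c]] assms(3)])
  then show ?thesis by (simp add: jmult_soc)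
qed

end

section \<open>The glued complex\<close>

locale glued_towers = self_inj_algebra sc for sc :: "'k::field \<Rightarrow> 'a::ring_1 \<Rightarrow> 'a" +
  fixes P :: "'a vec set" and n :: nat
  assumes P: "proj3 P" "P \<noteq> {0}" "local_mod P" and n: "0 < n"
begin

abbreviation T :: "nat \<Rightarrow> nat \<Rightarrow> 'a vec set" where "T j \<equiv> tower P (word j)"
abbreviation \<delta> :: "nat \<Rightarrow> nat \<Rightarrow> 'a vec \<Rightarrow> 'a vec" where "\<delta> j \<equiv> tdiff P (word j)"

definition Lev :: "nat \<Rightarrow> 'a vec set" where
  "Lev i = (if i = 0 then P else dsum n (\<lambda>j. T j i))"

text \<open>The index is that of the target: \<open>dl i\<close> leaves level
  \<open>Suc i\<close>.\<close>

definition dl :: "nat \<Rightarrow> 'a vec \<Rightarrow> 'a vec" where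
  "dl i v = (if i = 0 then \<Sum>j<n. \<delta> j 0 (coord j v) else \<Sum>j<n. emb j (\<delta> j i (coord j v)))"

lemma proj_T: "proj (T j i)" using proj3_tower[OF P(1)] by (simp add: proj3_def)
lemma submod_T: "submod (T j i)" using proj_submod[OF proj_T] .
lemma Lev_Suc: "Lev (Suc i) = dsum n (\<lambda>j. T j (Suc i))" by (simp add: Lev_def)
lemma proj_Lev: "proj (Lev i)"
  using P(1) proj_dsum[of n "\<lambda>j. T j i"] proj_T by (auto simp: Lev_def proj3_def)
lemma submod_Lev: "submod (Lev i)" using proj_submod[OF proj_Lev] .

lemma lin_coord_Lev: "j < n \<Longrightarrow> lin (Lev (Suc i)) (T j (Suc i)) (coord j)"
  unfolding Lev_Suc using lin_coord[of j n "\<lambda>j. T j (Suc i)"] .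

lemma lin_emb_Lev: "j < n \<Longrightarrow> lin (T j (Suc i)) (Lev (Suc i)) (emb j)"
  unfolding Lev_Suc using lin_emb[of j n "\<lambda>j. T j (Suc i)"] submod_T by blast

lemma lin_dl: "lin (Lev (Suc i)) (Lev i) (dl i)"
proof (cases i)
  case 0
  have "lin (Lev (Suc 0)) P (\<lambda>v. \<Sum>j<n. \<delta> j 0 (coord j v))"
  proof (rule lin_sum_fun[OF proj3_submod[OF P(1)]])
    fix j assume "j \<in> {..<n}"
    then show "lin (Lev (Suc 0)) P (\<lambda>v. \<delta> j 0 (coord j v))"
      using lin_comp[OF lin_coord_Lev lin_tdiff[OF P(1), of "word j" 0]] by simp
  qed
  then show ?thesis using 0 by (simp add: dl_def[abs_def] Lev_def[of 0])
next
  case (Suc m)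
  have "lin (Lev (Suc i)) (Lev i) (\<lambda>v. \<Sum>j<n. emb j (\<delta> j i (coord j v)))"
    using lin_comp[OF lin_comp[OF lin_coord_Lev lin_tdiff[OF P(1)]] lin_emb_Lev] submod_Lev Suc
    by (intro lin_sum_fun) auto
  then show ?thesis using Suc by (simp add: dl_def[abs_def])
qed

lemma coord_dl: "coord j (dl (Suc i) v) = (if j < n then \<delta> j (Suc i) (coord j v) else 0)"
  by (simp add: dl_def coord_sum_emb)

lemma dl_emb: "j < n \<Longrightarrow> dl (Suc i) (emb j b) = emb j (\<delta> j (Suc i) b)"
  by (rule vec_eq_coord) (auto simp: coord_dl coord_emb lin_zero[OF lin_tdiff[OF P(1)] submod_T])

lemma dl_dl:
  assumes v: "v \<in> Lev (Suc (Suc i))"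
  shows "dl i (dl (Suc i) v) = 0"
proof -
  have dd: "\<delta> j i (\<delta> j (Suc i) (coord j v)) = 0" if "j < n" for j
    using tdiff_tdiff[OF P(1) word_no_consecutive lin_mem[OF lin_coord_Lev[OF that] v]] .
  show ?thesis
  proof (cases i)
    case 0
    then show ?thesis using dd by (simp add: dl_def[of 0] coord_dl)
  next
    case (Suc m)
    show ?thesis
    proof (rule vec_eq_coord)
      fix j
      show "coord j (dl i (dl (Suc i) v)) = coord j 0"
        using dd[of j] unfolding Suc coord_dl by simp
    qed
  qed
qed

lemma dl_jmult:
  assumes v: "v \<in> Lev (Suc i)"
  shows "dl i v \<in> jmult (Lev i)"
proof -
  have c: "\<delta> j i (coord j v) \<in> jmult (T j i)" if "j < n" for j
    using tdiff_mem[OF P(1) lin_mem[OF lin_coord_Lev[OF that] v]] .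
  show ?thesis
  proof (cases i)
    case 0
    then show ?thesis using c by (auto simp: dl_def Lev_def intro!: submod_sum)
  next
    case (Suc m)
    show ?thesis
      using dsum_jmult[of n "\<lambda>j. T j i" "dl i v"] c submod_T lin_mem[OF lin_dl v]
      by (simp add: Suc coord_dl Lev_Suc)
  qed
qed

text \<open>From level 2 on the differential is diagonal with projective covers as entries; the map
  into \<open>P\<close> sums over the towers and can have a kernel outside the radical.\<close>

lemma ker_dl:
  assumes v: "v \<in> Lev (Suc (Suc i))" "dl (Suc i) v = 0"
  shows "v \<in> jmult (Lev (Suc (Suc i)))"
  unfolding Lev_Suc
proof (rule dsum_jmult[OF submod_T])
  fix j assume j: "j < n"
  have "\<delta> j (Suc i) (coord j v) = 0" using coord_dl[of j i v] v(2) j by simp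
  then show "coord j v \<in> jmult (T j (Suc (Suc i)))"
    using coverD(4)[OF cover_tower[OF P(1)] lin_mem[OF lin_coord_Lev[OF j] v(1)]] by blast
qed (use v in \<open>simp add: Lev_Suc\<close>)

section \<open>Nilpotence of chain endomorphisms\<close>

lemma bottom_zero_radical:
  assumes F: "\<And>i. i \<le> 5 * n \<Longrightarrow> lin (Lev i) (Lev i) (F i)"
    and comm: "\<And>i x. i < 5 * n \<Longrightarrow> x \<in> Lev (Suc i) \<Longrightarrow> dl i (F (Suc i) x) = F i (dl i x)"
    and zero: "\<And>x. x \<in> P \<Longrightarrow> F 0 x = 0" and v: "v \<in> Lev 1"
  shows "F 1 v \<in> jmult (Lev 1)"
proof -
  have n1: "1 \<le> 5 * n" using n by simp
  \<comment> \<open>\<open>A k j\<close> is the component from tower \<open>j\<close> to tower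
    \<open>k\<close>.\<close>
  define A where "A k j i b = coord k (F i (emb j b))" for k j i b
  have A: "lin (T j (Suc i)) (T k (Suc i)) (A k j (Suc i))" if "j < n" "k < n" "Suc i \<le> 5 * n" for k j i
    unfolding A_def
    by (rule lin_comp[OF lin_comp[OF lin_emb_Lev[OF that(1)] F[OF that(3)]] lin_coord_Lev[OF that(2)]])
  have Acomm: "A k j (Suc i) (\<delta> j (Suc i) b) = \<delta> k (Suc i) (A k j (Suc (Suc i)) b)"
    if "j < n" "k < n" "Suc i < 5 * n" "b \<in> T j (Suc (Suc i))" for k j i b
    using comm[OF that(3) lin_mem[OF lin_emb_Lev[OF that(1)] that(4)]] dl_emb[OF that(1), of i b]
      coord_dl[of k i "F (Suc (Suc i)) (emb j b)"] that(2)
    by (simp add: A_def)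
  have off: "A k j 1 b \<in> jmult (T k 1)" if jk: "j \<noteq> k" "j < n" "k < n" and b: "b \<in> T j 1" for k j b
  proof (rule tower_map_radical[OF P(1) jk _ _ b])
    fix i :: nat assume i: "1 \<le> i"
    then obtain i' where i': "i = Suc i'" by (cases i) auto
    show "lin (T j i) (T k i) (A k j i)" if "i \<le> 5 * n" using A[OF jk(2,3)] that i' by simp
    show "A k j i (\<delta> j i x) = \<delta> k i (A k j (Suc i) x)" if "i < 5 * n" "x \<in> T j (Suc i)" for x
      using Acomm[OF jk(2,3)] that i' by simp
  qed
  have diag: "A j j 1 b \<in> jmult (T j 1)" if j: "j < n" and b: "b \<in> T j 1" for j b
  proof -
    have Ab: "A j j 1 b \<in> T j 1" using lin_mem[OF A[OF j j, of 0]] b n1 by simp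
    have eb: "emb j b \<in> Lev (Suc 0)" using lin_mem[OF lin_emb_Lev[OF j, of 0]] b by simp
    have "dl 0 (F 1 (emb j b)) = F 0 (dl 0 (emb j b))" using comm[of 0, OF _ eb] n by simp
    also have "\<dots> = 0" using zero lin_mem[OF lin_dl eb] by (simp add: Lev_def)
    finally have "0 = (\<Sum>k<n. \<delta> k 0 (A k j 1 b))" by (simp add: dl_def A_def)
    \<comment> \<open>The off-diagonal components lie in the radical, which
      \<open>\<delta> k 0\<close> kills because it maps onto the socle of \<open>P\<close>. The
      surviving diagonal component lies in the kernel of a cover.\<close>
    also have "\<dots> = (\<Sum>k<n. if j = k then \<delta> k 0 (A k j 1 b) else 0)"
      using tdiff_0_jmult[OF P(1) word_0 off[OF _ j _ b]] by (intro sum.cong) auto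
    also have "\<dots> = \<delta> j 0 (A j j 1 b)" using j by simp
    finally show ?thesis using coverD(4)[OF cover_tower[OF P(1), of "word j" 0], of "A j j 1 b"] Ab by simp
  qed
  have sub: "F 1 (emb j b) \<in> jmult (Lev 1)" if j: "j < n" and b: "b \<in> T j 1" for j b
  proof -
    have "F 1 (emb j b) \<in> Lev 1"
      using lin_mem[OF F[OF n1]] lin_mem[OF lin_emb_Lev[OF j, of 0]] b by simp
    moreover have "coord k (F 1 (emb j b)) \<in> jmult (T k 1)" if k: "k < n" for k
      using off[OF _ j k b] diag[OF j b] by (cases "j = k") (auto simp: A_def)
    ultimately show ?thesis using dsum_jmult[of n "\<lambda>j. T j 1"] submod_T by (simp add: Lev_def)
  qed
  have cv: "coord j v \<in> T j 1" if "j < n" for j using lin_mem[OF lin_coord_Lev[OF that, of 0]] v by simp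
  have "F 1 v = F 1 (\<Sum>j<n. emb j (coord j v))"
    using dsum_expand[of v n "\<lambda>j. T j 1"] v by (simp add: Lev_def)
  also have "\<dots> = (\<Sum>j<n. F 1 (emb j (coord j v)))"
    by (rule lin_sum[OF F[OF n1] submod_Lev]) (use lin_mem[OF lin_emb_Lev[of _ 0]] cv in auto)
  also have "\<dots> \<in> jmult (Lev 1)" using sub cv by (intro submod_sum) auto
  finally show ?thesis .
qed

lemma endo_nilpotent:
  assumes F: "\<And>i. i \<le> 5 * n \<Longrightarrow> lin (Lev i) (Lev i) (F i)"
    and comm: "\<And>i x. i < 5 * n \<Longrightarrow> x \<in> Lev (Suc i) \<Longrightarrow> dl i (F (Suc i) x) = F i (dl i x)"
    and rad: "\<And>x. x \<in> P \<Longrightarrow> F 0 x \<in> jmult P"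
  shows "\<exists>k. \<forall>i\<le>5 * n. \<forall>x\<in>Lev i. (F i ^^ k) x = 0"
proof -
  have comm_pow: "dl i ((F (Suc i) ^^ k) x) = (F i ^^ k) (dl i x)" if "i < 5 * n" "x \<in> Lev (Suc i)" for i k x
    using that(2)
  proof (induction k)
    case (Suc k)
    have "(F (Suc i) ^^ k) x \<in> Lev (Suc i)" using funpow_mem[OF F] that by simp
    then show ?case using comm[OF that(1)] Suc by simp
  qed simp
  have "\<exists>k. \<forall>x\<in>Lev i. (F i ^^ k) x = 0" if "i \<le> 5 * n" for i
    using that
  proof (induction i)
    case 0
    then show ?case using radical_nilpotent[OF fdm_proj[OF proj_Lev] F[OF 0]] rad by (simp add: Lev_def)
  next
    case (Suc i)
    then obtain k where k: "\<And>x. x \<in> Lev i \<Longrightarrow> (F i ^^ k) x = 0" by auto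
    let ?G = "F (Suc i) ^^ k"
    have G: "lin (Lev (Suc i)) (Lev (Suc i)) ?G" using lin_funpow[OF F[OF Suc.prems]] .
    \<comment> \<open>A power vanishing on level \<open>i\<close> maps level \<open>Suc i\<close>
      into the kernel of \<open>dl i\<close>. Above level 1 this kernel is radical; level 1 needs
      the comparison of the words.\<close>
    have "?G x \<in> jmult (Lev (Suc i))" if x: "x \<in> Lev (Suc i)" for x
    proof (cases i)
      case 0
      show ?thesis
        using bottom_zero_radical[of "\<lambda>i. F i ^^ k" x] lin_funpow[OF F] comm_pow k x
        by (simp add: 0 Lev_def[of 0])
    next
      case (Suc m)
      have "dl i (?G x) = 0" using comm_pow[OF _ x] k lin_mem[OF lin_dl x] Suc.prems by simp
      then show ?thesis using ker_dl[of "?G x" m] lin_mem[OF G x] Suc by simp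
    qed
    then obtain k' where "\<forall>x\<in>Lev (Suc i). (?G ^^ k') x = 0"
      using radical_nilpotent[OF fdm_proj[OF proj_Lev] G] by blast
    then show ?case by (intro exI[of _ "k * k'"]) (simp add: funpow_mult)
  qed
  then have "\<forall>i. \<exists>k. i \<le> 5 * n \<longrightarrow> (\<forall>x\<in>Lev i. (F i ^^ k) x = 0)" by blast
  then obtain k where k: "\<And>i x. i \<le> 5 * n \<Longrightarrow> x \<in> Lev i \<Longrightarrow> (F i ^^ k i) x = 0" by metis
  have "(F i ^^ Max (k ` {..5 * n})) x = 0" if "i \<le> 5 * n" "x \<in> Lev i" for i x
    using funpow_zero_mono[OF F[OF that(1)] submod_Lev k[OF that]] that(1) by simp
  then show ?thesis by blast
qed

section \<open>The complex in homological degrees\<close>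

definition X :: "'a cpx" where
  "X = ((\<lambda>m. if - int (5 * n) \<le> m \<and> m \<le> 0 then Lev (nat (m + int (5 * n))) else {0}),
    (\<lambda>m. if - int (5 * n) < m \<and> m \<le> 0 then dl (nat (m + int (5 * n)) - 1) else (\<lambda>_. 0)))"

text \<open>Shifted so that the top level \<open>5 * n\<close> sits in degree 0, where homology is
  measured.\<close>

definition deg :: "nat \<Rightarrow> int" where "deg i = int i - int (5 * n)"

lemma deg_Suc: "deg (Suc i) - 1 = deg i" "deg i + 1 = deg (Suc i)"
  by (simp_all add: deg_def)

lemma X_mod: "i \<le> 5 * n \<Longrightarrow> fst X (deg i) = Lev i"
  by (simp add: X_def deg_def)

lemma X_diff: "i < 5 * n \<Longrightarrow> snd X (deg (Suc i)) = dl i"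
  by (simp add: X_def deg_def nat_add_distrib)

lemma X_diff_bottom: "snd X (deg 0) = (\<lambda>_. 0)"
  by (simp add: X_def deg_def)

lemma X_cases:
  obtains i where "i \<le> 5 * n" "m = deg i" | "fst X m = {0}" "snd X m = (\<lambda>_. 0)"
proof (cases "- int (5 * n) \<le> m \<and> m \<le> 0")
  case True
  then have "nat (m + int (5 * n)) \<le> 5 * n" "m = deg (nat (m + int (5 * n)))" by (auto simp: deg_def)
  then show ?thesis using that(1) by blast
next
  case False
  then show ?thesis using that(2) by (auto simp: X_def)
qed

lemma X_cases_diff:
  obtains i where "i < 5 * n" "m = deg (Suc i)" "m - 1 = deg i" | "snd X m = (\<lambda>_. 0)"
proof (cases rule: X_cases[of m])
  case (1 i)
  then show ?thesis
  proof (cases i)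
    case 0
    then show ?thesis using 1 that(2) X_diff_bottom by simp
  next
    case (Suc i')
    then show ?thesis using 1 that(1)[of i'] deg_Suc by simp
  qed
qed (use that in blast)

lemma proj_X: "proj (fst X m)"
  by (cases rule: X_cases[of m]) (simp_all add: X_mod proj_Lev proj_zero)

lemma submod_X: "submod (fst X m)"
  using proj_submod[OF proj_X] .

lemma lin_X: "lin (fst X m) (fst X (m - 1)) (snd X m)"
proof (cases rule: X_cases_diff[of m])
  case (1 i)
  then show ?thesis using X_mod[of i] X_mod[of "Suc i"] X_diff[of i] lin_dl[of i] by simp
next
  case 2
  then show ?thesis using lin_const_zero[OF submod_X] by simp
qed

lemma X_dd: "x \<in> fst X m \<Longrightarrow> snd X (m - 1) (snd X m x) = 0"
proof (cases rule: X_cases_diff[of m])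
  case (1 i)
  assume x: "x \<in> fst X m"
  show ?thesis
  proof (cases i)
    case 0
    then show ?thesis using 1 X_diff_bottom by simp
  next
    case (Suc i')
    have "m - 1 = deg (Suc i')" using 1 Suc by simp
    then have "snd X (m - 1) = dl i'" using X_diff[of i'] 1(1) Suc by simp
    moreover have "snd X m = dl (Suc i')" using X_diff[of i] 1 Suc by simp
    ultimately show ?thesis using dl_dl[of x i'] x X_mod[of "Suc i"] 1 Suc by simp
  qed
next
  case 2
  then show ?thesis using lin_zero[OF lin_X submod_X] by simp
qed

lemma perfect_X: "perfect X"
proof -
  have "fst X m = {0}" if "\<bar>m\<bar> > int (5 * n)" for m using that by (auto simp: X_def)
  then have "\<exists>B. \<forall>m. \<bar>m\<bar> > B \<longrightarrow> fst X m = {0}" by blast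
  then show ?thesis unfolding perfect_def using fg_proj_proj[OF proj_X] lin_X X_dd by blast
qed

lemma chain_endo_nilpotent:
  assumes f: "chain_map X X f" and rad: "\<And>x. x \<in> P \<Longrightarrow> f (deg 0) x \<in> jmult P"
  shows "\<exists>k. \<forall>m. \<forall>x\<in>fst X m. (f m ^^ k) x = 0"
proof -
  have f': "\<And>m. lin (fst X m) (fst X m) (f m)"
    "\<And>m x. x \<in> fst X m \<Longrightarrow> snd X m (f m x) = f (m - 1) (snd X m x)"
    using f by (auto simp: chain_map_def)
  have "\<exists>k. \<forall>i\<le>5 * n. \<forall>x\<in>Lev i. (f (deg i) ^^ k) x = 0"
  proof (rule endo_nilpotent)
    show "lin (Lev i) (Lev i) (f (deg i))" if "i \<le> 5 * n" for i
      using f'(1)[of "deg i"] X_mod[OF that] by simp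
    show "dl i (f (deg (Suc i)) x) = f (deg i) (dl i x)" if "i < 5 * n" "x \<in> Lev (Suc i)" for i x
      using f'(2)[of x "deg (Suc i)"] deg_Suc(1) X_mod[of "Suc i"] X_diff[OF that(1)] that by simp
    show "f (deg 0) x \<in> jmult P" if "x \<in> P" for x using rad[OF that] .
  qed
  then obtain k where k: "\<And>i x. i \<le> 5 * n \<Longrightarrow> x \<in> Lev i \<Longrightarrow> (f (deg i) ^^ k) x = 0" by blast
  have "(f m ^^ k) x = 0" if x: "x \<in> fst X m" for m x
  proof (cases rule: X_cases[of m])
    case (1 i)
    then show ?thesis using k[of i x] X_mod x by simp
  next
    case 2
    then have "(f m ^^ k) x \<in> {0}" using funpow_mem[OF f'(1) x, of k] by simp
    then show ?thesis by simp
  qed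
  then show ?thesis by blast
qed

lemma bottom: "fst X (deg 0) = P" "\<And>x. x \<in> fst X (deg 0 + 1) \<Longrightarrow> snd X (deg 0 + 1) x \<in> jmult P"
proof -
  show P0: "fst X (deg 0) = P" using X_mod[of 0] by (simp add: Lev_def)
  fix x assume x: "x \<in> fst X (deg 0 + 1)"
  have 1: "deg 0 + 1 = deg (Suc 0)" by (rule deg_Suc)
  show "snd X (deg 0 + 1) x \<in> jmult P"
    using dl_jmult[of x 0] x X_diff[of 0] X_mod[of "Suc 0"] n unfolding 1 by (simp add: Lev_def[of 0])
qed

section \<open>Indecomposability\<close>

lemma not_contractible_X: "\<not> contractible X"
proof
  assume "contractible X"
  then obtain h where h: "\<And>m. lin (fst X m) (fst X (m + 1)) (h m)"
    "\<And>m x. x \<in> fst X m \<Longrightarrow> x - 0 = snd X (m + 1) (h m x) + h (m - 1) (snd X m x)"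
    unfolding contractible_def homotopic_def cid_def czero_def by blast
  \<comment> \<open>A contraction writes \<open>x\<close> as a boundary, and boundaries in
    \<open>P\<close> lie in \<open>J P\<close>.\<close>
  have "x \<in> jmult P" if x: "x \<in> P" for x
  proof -
    have xX: "x \<in> fst X (deg 0)" using x bottom by simp
    have "x = snd X (deg 0 + 1) (h (deg 0) x)"
      using h(2)[OF xX] lin_zero[OF h(1) submod_X] X_diff_bottom by simp
    then show ?thesis using bottom(2)[OF lin_mem[OF h(1) xX]] by simp
  qed
  then have "jmult P = P" using jmult_subset[OF proj3_submod[OF P(1)]] by blast
  then show False using nakayama[OF fdm_proj] P by (auto simp: proj3_def)
qed

text \<open>The composite of \<open>p\<close> and \<open>i\<close> is nilpotent once it is radical
  on \<open>P\<close>, and this makes the homotopy retract \<open>Y\<close> contractible.\<close>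

lemma contractible_summand:
  assumes Y: "perfect Y" and i: "chain_map Y X i" and p: "chain_map X Y p"
    and id: "homotopic Y Y (ccomp p i) cid"
    and rad: "\<And>x. x \<in> P \<Longrightarrow> i (deg 0) (p (deg 0) x) \<in> jmult P"
  shows "contractible Y"
proof -
  have Y': "\<And>m. submod (fst Y m)" "\<And>m. lin (fst Y m) (fst Y (m - 1)) (snd Y m)"
    using Y by (auto simp: perfect_def fg_proj_def)
  have f: "chain_map X X (\<lambda>m x. i m (p m x))"
    using i p lin_comp by (fastforce simp: chain_map_def dest: lin_mem)
  obtain k where "\<forall>m. \<forall>x\<in>fst X m. ((\<lambda>x. i m (p m x)) ^^ k) x = 0"
    using chain_endo_nilpotent[OF f rad] by blast
  then show ?thesis using contractible_if_nilpotent[OF submod_X Y' i p id] by blast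
qed

lemma indecomposable_X: "indecomposable X"
  unfolding indecomposable_def
proof (intro conjI perfect_X not_contractible_X allI impI, elim conjE)
  fix Y Z :: "'a cpx" assume Y: "perfect Y" and Z: "perfect Z" and "is_biproduct X Y Z"
  then obtain i1 i2 p1 p2 where i: "chain_map Y X i1" "chain_map Z X i2" and p: "chain_map X Y p1" "chain_map X Z p2"
    and id: "homotopic Y Y (ccomp p1 i1) cid" "homotopic Z Z (ccomp p2 i2) cid"
    and sum: "homotopic X X (\<lambda>n x. i1 n (p1 n x) + i2 n (p2 n x)) cid"
    unfolding is_biproduct_def by blast
  let ?b = "deg 0"
  define g where "g x = i1 ?b (p1 ?b x)" for x
  have i1: "\<And>m. lin (fst Y m) (fst X m) (i1 m)" "\<And>m x. x \<in> fst Y m \<Longrightarrow> snd X m (i1 m x) = i1 (m - 1) (snd Y m x)"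
    and p1: "\<And>m. lin (fst X m) (fst Y m) (p1 m)" "\<And>m x. x \<in> fst X m \<Longrightarrow> snd Y m (p1 m x) = p1 (m - 1) (snd X m x)"
    using i(1) p(1) by (auto simp: chain_map_def)
  have Y': "\<And>m. submod (fst Y m)" "\<And>m. lin (fst Y m) (fst Y (m - 1)) (snd Y m)"
    using Y by (auto simp: perfect_def fg_proj_def)
  have P0: "fst X ?b = P" by (rule bottom(1))
  have "lin (fst X ?b) (fst X ?b) (\<lambda>x. i1 ?b (p1 ?b x))" by (rule lin_comp[OF p1(1) i1(1)])
  then have g: "lin P P g" unfolding P0 g_def .
  have idem: "g (g x) - g x \<in> jmult P" if x: "x \<in> P" for x
  proof -
    obtain h where h: "\<And>m. lin (fst Y m) (fst Y (m + 1)) (h m)"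
      "\<And>m x. x \<in> fst Y m \<Longrightarrow> p1 m (i1 m x) - x = snd Y (m + 1) (h m x) + h (m - 1) (snd Y m x)"
      using id(1) unfolding homotopic_def ccomp_def cid_def by blast
    let ?y = "p1 ?b x"
    have xX: "x \<in> fst X ?b" using x P0 by simp
    have y: "?y \<in> fst Y ?b" using lin_mem[OF p1(1) xX] .
    \<comment> \<open>\<open>Y\<close> may live below this degree, but \<open>?y\<close> is a cycle
      because \<open>x\<close> is one. So the homotopy contributes only a boundary, which
      \<open>i1\<close> carries to a boundary in \<open>P\<close>.\<close>
    have "snd Y ?b ?y = 0" using p1(2)[OF xX] X_diff_bottom lin_zero[OF p1(1) submod_X] by simp
    then have "p1 ?b (i1 ?b ?y) - ?y = snd Y (?b + 1) (h ?b ?y)"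
      using h(2)[OF y] lin_zero[OF h(1) Y'(1)] by simp
    moreover have "g (g x) - g x = i1 ?b (p1 ?b (i1 ?b ?y) - ?y)"
      unfolding g_def using lin_diff[OF i1(1) Y'(1) lin_mem[OF p1(1) lin_mem[OF i1(1) y]] y] by simp
    ultimately have "g (g x) - g x = snd X (?b + 1) (i1 (?b + 1) (h ?b ?y))"
      using i1(2)[OF lin_mem[OF h(1) y]] by simp
    then show ?thesis using bottom(2)[OF lin_mem[OF i1(1) lin_mem[OF h(1) y]]] by simp
  qed
  consider "\<forall>x\<in>P. g x \<in> jmult P" | "\<forall>x\<in>P. x - g x \<in> jmult P"
    using P(3) g idem unfolding local_mod_def by blast
  then show "contractible Y \<or> contractible Z"
  proof cases
    case 1
    then show ?thesis using contractible_summand[OF Y i(1) p(1) id(1)] by (simp add: g_def)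
  next
    case 2
    \<comment> \<open>On \<open>P\<close> the second projector is the identity minus
      \<open>g\<close> up to a boundary, so it is radical in this case.\<close>
    have "i2 ?b (p2 ?b x) \<in> jmult P" if x: "x \<in> P" for x
    proof -
      obtain h where h: "\<And>m. lin (fst X m) (fst X (m + 1)) (h m)"
        "\<And>m x. x \<in> fst X m \<Longrightarrow> i1 m (p1 m x) + i2 m (p2 m x) - x = snd X (m + 1) (h m x) + h (m - 1) (snd X m x)"
        using sum unfolding homotopic_def cid_def by blast
      have xX: "x \<in> fst X ?b" using x P0 by simp
      have "g x + i2 ?b (p2 ?b x) - x = snd X (?b + 1) (h ?b x)"
        using h(2)[OF xX] X_diff_bottom lin_zero[OF h(1) submod_X] by (simp add: g_def)
      then have "i2 ?b (p2 ?b x) = (x - g x) + snd X (?b + 1) (h ?b x)" by (simp add: algebra_simps)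
      then show ?thesis
        using submod_add[OF submod_jmult] 2 x bottom(2)[OF lin_mem[OF h(1) xX]] by metis
    qed
    then show ?thesis using contractible_summand[OF Z i(2) p(2) id(2)] by blast
  qed
qed

section \<open>Dimension of the top homology\<close>

lemma H0_dim_X: "n \<le> H0_dim sc X"
proof -
  obtain K where K: "5 * n = Suc K" using n by (cases "5 * n") auto
  let ?B = "\<lambda>j. T j (Suc K)"
  have d0: "fst X 0 = Lev (Suc K)" "snd X 0 = dl K"
    using X_mod[of "Suc K"] X_diff[of K] by (simp_all add: K deg_def)
  have "\<exists>z. z \<in> soc (?B j) \<and> z \<noteq> 0" for j
    using soc_nonzero[OF fdm_proj[OF proj_T] tower_nonzero[OF P(1,2)]] by blast
  then obtain z where z: "\<And>j. z j \<in> soc (?B j)" "\<And>j. z j \<noteq> 0" by metis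
  define V where "V = {x \<in> fst X 0. snd X 0 x = 0}"
  have zV: "emb j (z j) \<in> V" if j: "j < n" for j
  proof -
    have zB: "z j \<in> ?B j" using z(1) soc_subset by blast
    have e: "emb j (z j) \<in> Lev (Suc K)" using lin_mem[OF lin_emb_Lev[OF j] zB] .
    have "act a (emb j (z j)) = 0" if "a \<in> J" for a
      using z(1)[of j] that by (simp add: soc_def emb_act[symmetric])
    then have "emb j (z j) \<in> soc (Lev (Suc K))" using e by (simp add: soc_def)
    then have "dl K (emb j (z j)) = 0"
      using radical_kills_soc[OF proj_Lev proj_Lev lin_dl dl_jmult] by blast
    then show ?thesis using e d0 by (simp add: V_def)
  qed
  let ?e = "\<lambda>j. emb j (z j)"
  have coord_e: "coord k (?e j) = (if k = j then z j else 0)" for j k by (simp add: coord_emb)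
  have inj: "inj_on ?e {..<n}" using coord_e z(2) by (intro inj_onI) metis
  have "vec.independent (?e ` {..<n})"
  proof (rule vec.independent_if_scalars_zero)
    fix c x assume s: "(\<Sum>x\<in>?e ` {..<n}. vsc sc (c x) x) = 0" and "x \<in> ?e ` {..<n}"
    then obtain j where j: "j < n" "x = ?e j" by blast
    have "0 = (\<Sum>k<n. vsc sc (c (?e k)) (?e k))" using s sum.reindex[OF inj, of "\<lambda>x. vsc sc (c x) x"] by simp
    then have "coord j 0 = coord j (\<Sum>k<n. vsc sc (c (?e k)) (?e k))" by simp
    also have "\<dots> = (\<Sum>k<n. coord j (act (sc (c (?e k)) 1) (?e k)))"
      by (simp only: coord_sum vsc_act)
    also have "\<dots> = (\<Sum>k<n. if j = k then vsc sc (c (?e k)) (z k) else 0)"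
      by (intro sum.cong) (auto simp: coord_act coord_e vsc_act)
    also have "\<dots> = vsc sc (c x) (z j)" using j by simp
    finally have "vsc sc (c x) (z j) = 0" by simp
    then show "c x = 0" using z(2) vec.scale_eq_0_iff by blast
  qed simp
  moreover obtain S where "finite S" "fst X 0 \<subseteq> vec.span S"
    using fdm_proj[OF proj_X, of 0] by (auto simp: fdm_def)
  moreover have "?e ` {..<n} \<subseteq> V" using zV by blast
  moreover have "V \<subseteq> fst X 0" by (auto simp: V_def)
  ultimately have "card (?e ` {..<n}) \<le> vec.dim V" using vec.dim_ge_card by (metis order_trans)
  then have nV: "n \<le> vec.dim V" using card_image[OF inj] by simp
  \<comment> \<open>Nothing lies above degree 0, so the truncated subtraction in
    \<open>H0_dim\<close> removes 0.\<close>
  have "snd X 1 ` fst X 1 = {0}" by (simp add: X_def)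
  moreover have "vec.dim {0} \<le> 0"
    using vec.dim_le_card[of "{0}" "{}"] by simp
  ultimately show ?thesis using nV by (simp add: H0_dim_def V_def)
qed

end

theorem theorem5p1:
  fixes sc :: "'k::field \<Rightarrow> 'a::ring_1 \<Rightarrow> 'a" and N :: nat
  assumes "fd_algebra sc"
    and "self_injective TYPE('a)"
    and "radical_length TYPE('a) \<ge> 3"
  shows "\<exists>X :: 'a cpx. indecomposable X \<and> H0_dim sc X > N"
proof -
  interpret self_inj_algebra sc using assms by unfold_locales
  have "\<exists>a\<in>J. \<exists>b\<in>J. a * b \<noteq> 0"
  proof (rule ccontr)
    assume neg: "\<not> ?thesis"
    \<comment> \<open>Vanishing of all twofold products would make 2 a candidate for the least
      exponent.\<close>
    have "ideal_pow J 2 = {0}"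
    proof
      have "prod_list xs = 0" if xs: "length xs = 2" "set xs \<subseteq> J" for xs
      proof -
        obtain a b where "xs = [a, b]" using xs(1) by (auto simp: numeral_2_eq_2 length_Suc_conv)
        then show ?thesis using xs(2) neg by auto
      qed
      then show "ideal_pow J 2 \<subseteq> {0}" unfolding ideal_pow_def by (intro Inter_lower) auto
      show "{0} \<subseteq> ideal_pow J 2" by (auto simp: ideal_pow_def)
    qed
    then have "radical_length TYPE('a) \<le> 2" unfolding radical_length_def by (rule Least_le)
    then show False using assms(3) by simp
  qed
  then obtain P where P: "proj3 P" "P \<noteq> {0}" "local_mod P" using ex_proj3_local by blast
  \<comment> \<open>\<open>Suc N\<close> towers, for the strict inequality.\<close>
  interpret glued_towers sc P "Suc N" using P by unfold_locales auto
  show ?thesis using indecomposable_X H0_dim_X by (intro exI[of _ X]) auto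
qed

end
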